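(* Let $1\le n<m$ and let $G$ be the clique sum of two odd cycles $C_1=(x_1,\ldots,x_{2n+1})$ and $C_2=(x_1,y_2,\ldots,y_{2m+1})$ joined at the vertex $x_1$. Let $I=I(G)$ be the edge ideal of $G$, and let $c_1=x_1x_2\cdots x_{2n+1}$ and $c_2=x_1y_2\cdots y_{2m+1}$. Then: (1) for $1\le t\le n$, $I^{(t)}=I^t$; (2) $I^{(n+1)}=I^{n+1}+(c_1)$; (3) for $n+2\le t\le m+1$, $I^{(t)}=I^t+(D(t))$.
   Context: Let $k$ be a field. For a finite simple graph $G$, the edge ideal $I(G)$ is the ideal generated by all products $uv$ with $\{u,v\}$ an edge of $G$, in the polynomial ring over $k$ whose variables are the vertices of $G$. The $t$-th symbolic power of an ideal $I$ of a ring $R$ is $I^{(t)}=\bigcap_{p\in\operatorname{Ass} I}(I^tR_p\cap R)$; for an edge ideal it equals $\bigcap_V P_V^t$, where $V$ runs over the minimal vertex covers of $G$ and $P_V$ is the ideal generated by the variables in $V$. The clique sum of the cycles $C_1=(x_1,x_2,\ldots,x_{2n+1})$ and $C_2=(x_1,y_2,\ldots,y_{2m+1})$ joined at $x_1$ is the union of the two cycles (consecutive vertices adjacent, last vertex adjacent to $x_1$), which share exactly the vertex $x_1$ and no edge. For a set of vertices $V$ and a monomial $M$, the vertex weight $W_V(M)$ is the sum of the exponents in $M$ of the variables belonging to $V$. For $t\ge 1$, $D(t)$ is the set of monomials $M$ with $\deg M<2t$ and $W_V(M)\ge t$ for all minimal vertex covers $V$ of $G$; $(D(t))$ is the ideal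 it generates. *)

theory Defs
  imports "HOL-Library.Poly_Mapping" "HOL-Algebra.Ideal_Product" "HOL-Algebra.QuotRing"
begin

text \<open>The associated primes of the module \<open>R/I\<close>: the prime ideals that are the annihilator of
  the class of some \<open>f\<close>.\<close>

definition ass_primes :: "('a, 'b) ring_scheme \<Rightarrow> 'a set \<Rightarrow> 'a set set"
  where "ass_primes R I =
    {p. primeideal p R \<and>
        (\<exists>f \<in> carrier R. p = {r \<in> carrier R. I +>\<^bsub>R\<^esub> (r \<otimes>\<^bsub>R\<^esub> f) = \<zero>\<^bsub>R Quot I\<^esub>})}"

text \<open>The localization \<open>S\<^sup>-\<^sup>1 R\<close> as a ring of equivalence classes of pairs (numerator, denominator).
  Sums and products of classes are unions over all representatives, as usual for quotients.\<close>

definition frac_rel :: "('a, 'b) ring_scheme \<Rightarrow> 'a set \<Rightarrow> (('a \<times> 'a) \<times> ('a \<times> 'a)) set"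
  where "frac_rel R S =
    {((a, s), (b, u)). a \<in> carrier R \<and> b \<in> carrier R \<and> s \<in> S \<and> u \<in> S \<and>
       (\<exists>w \<in> S. w \<otimes>\<^bsub>R\<^esub> (a \<otimes>\<^bsub>R\<^esub> u) = w \<otimes>\<^bsub>R\<^esub> (b \<otimes>\<^bsub>R\<^esub> s))}"

definition frac :: "('a, 'b) ring_scheme \<Rightarrow> 'a set \<Rightarrow> 'a \<Rightarrow> 'a \<Rightarrow> ('a \<times> 'a) set"
  where "frac R S a s = frac_rel R S `` {(a, s)}"

definition localization :: "('a, 'b) ring_scheme \<Rightarrow> 'a set \<Rightarrow> ('a \<times> 'a) set ring"
  where "localization R S =
    \<lparr> carrier = (carrier R \<times> S) // frac_rel R S,
      mult = (\<lambda>X Y. \<Union>(a, s) \<in> X. \<Union>(b, u) \<in> Y. frac R S (a \<otimes>\<^bsub>R\<^esub> b) (s \<otimes>\<^bsub>R\<^esub> u)),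
      one = frac R S \<one>\<^bsub>R\<^esub> \<one>\<^bsub>R\<^esub>,
      zero = frac R S \<zero>\<^bsub>R\<^esub> \<one>\<^bsub>R\<^esub>,
      add = (\<lambda>X Y. \<Union>(a, s) \<in> X. \<Union>(b, u) \<in> Y.
        frac R S ((a \<otimes>\<^bsub>R\<^esub> u) \<oplus>\<^bsub>R\<^esub> (b \<otimes>\<^bsub>R\<^esub> s)) (s \<otimes>\<^bsub>R\<^esub> u)) \<rparr>"

abbreviation local_ring_at :: "('a, 'b) ring_scheme \<Rightarrow> 'a set \<Rightarrow> ('a \<times> 'a) set ring"
  where "local_ring_at R p \<equiv> localization R (carrier R - p)"

text \<open>\<open>J R\<^sub>p \<inter> R\<close>: the preimage under the canonical map \<open>R \<rightarrow> R\<^sub>p\<close> of the ideal of \<open>R\<^sub>p\<close>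
  generated by the image of \<open>J\<close>.\<close>

definition local_contraction :: "('a, 'b) ring_scheme \<Rightarrow> 'a set \<Rightarrow> 'a set \<Rightarrow> 'a set"
  where "local_contraction R p J =
    {f \<in> carrier R.
       frac R (carrier R - p) f \<one>\<^bsub>R\<^esub> \<in>
         Idl\<^bsub>local_ring_at R p\<^esub> ((\<lambda>g. frac R (carrier R - p) g \<one>\<^bsub>R\<^esub>) ` J)}"

text \<open>Ordinary powers are powers in the library's monoid of ideals \<^const>\<open>ideals_set\<close>.\<close>

abbreviation ideal_power :: "('a, 'b) ring_scheme \<Rightarrow> 'a set \<Rightarrow> nat \<Rightarrow> 'a set"
  where "ideal_power R I t \<equiv> I [^]\<^bsub>ideals_set R\<^esub> t"

text \<open>The intersection with the carrier only matters when there are no associated primes, e.g. for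
  \<open>I = R\<close>.\<close>

definition symbolic_power :: "('a, 'b) ring_scheme \<Rightarrow> 'a set \<Rightarrow> nat \<Rightarrow> 'a set"
  where "symbolic_power R I t =
    carrier R \<inter> (\<Inter>p \<in> ass_primes R I. local_contraction R p (ideal_power R I t))"

text \<open>The polynomial ring over \<open>'k\<close> with variable set exactly \<open>V\<close>: those polynomials in variables
  of type \<open>'v\<close> in which only variables from \<open>V\<close> occur. A monomial is given by its exponent vector
  \<open>e :: 'v \<Rightarrow>\<^sub>0 nat\<close>.\<close>

definition poly_ring :: "'v set \<Rightarrow> (('v \<Rightarrow>\<^sub>0 nat) \<Rightarrow>\<^sub>0 'k::field) ring"
  where "poly_ring V =
    \<lparr> carrier = {p. \<forall>e \<in> Poly_Mapping.keys p. Poly_Mapping.keys e \<subseteq> V},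
      mult = (*), one = 1, zero = 0, add = (+) \<rparr>"

definition monomial :: "('v \<Rightarrow>\<^sub>0 nat) \<Rightarrow> (('v \<Rightarrow>\<^sub>0 nat) \<Rightarrow>\<^sub>0 'k::field)"
  where "monomial e = Poly_Mapping.single e 1"

definition pvar :: "'v \<Rightarrow> (('v \<Rightarrow>\<^sub>0 nat) \<Rightarrow>\<^sub>0 'k::field)"
  where "pvar v = monomial (Poly_Mapping.single v 1)"

text \<open>A graph is given by its vertex set \<open>V\<close> and its set \<open>E\<close> of edges \<open>{u, v}\<close>.\<close>

definition edge_ideal :: "'v set \<Rightarrow> 'v set set \<Rightarrow> (('v \<Rightarrow>\<^sub>0 nat) \<Rightarrow>\<^sub>0 'k::field) set"
  where "edge_ideal V E = Idl\<^bsub>poly_ring V\<^esub> {pvar u * pvar v | u v. {u, v} \<in> E}"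

definition vertex_cover :: "'v set \<Rightarrow> 'v set set \<Rightarrow> 'v set \<Rightarrow> bool"
  where "vertex_cover V E C \<longleftrightarrow> C \<subseteq> V \<and> (\<forall>e \<in> E. e \<inter> C \<noteq> {})"

definition minimal_vertex_cover :: "'v set \<Rightarrow> 'v set set \<Rightarrow> 'v set \<Rightarrow> bool"
  where "minimal_vertex_cover V E C \<longleftrightarrow>
    vertex_cover V E C \<and> (\<forall>C'. C' \<subset> C \<longrightarrow> \<not> vertex_cover V E C')"

definition mon_deg :: "('v \<Rightarrow>\<^sub>0 nat) \<Rightarrow> nat"
  where "mon_deg e = (\<Sum>v \<in> Poly_Mapping.keys e. Poly_Mapping.lookup e v)"

text \<open>Used for finite \<open>C\<close> only, as vertex covers of finite graphs are finite.\<close>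

definition vertex_weight :: "'v set \<Rightarrow> ('v \<Rightarrow>\<^sub>0 nat) \<Rightarrow> nat"
  where "vertex_weight C e = (\<Sum>v \<in> C. Poly_Mapping.lookup e v)"

definition D_set :: "'v set \<Rightarrow> 'v set set \<Rightarrow> nat \<Rightarrow> (('v \<Rightarrow>\<^sub>0 nat) \<Rightarrow>\<^sub>0 'k::field) set"
  where "D_set V E t =
    {monomial e | e. Poly_Mapping.keys e \<subseteq> V \<and> mon_deg e < 2 * t \<and>
       (\<forall>C. minimal_vertex_cover V E C \<longrightarrow> t \<le> vertex_weight C e)}"

text \<open>The edges of the cycle \<open>(z 1, \<dots>, z l)\<close>; meaningful for \<open>z\<close> injective on \<open>{1..l}\<close> and \<open>l \<ge> 3\<close>.\<close>

definition cycle_edges :: "(nat \<Rightarrow> 'v) \<Rightarrow> nat \<Rightarrow> 'v set set"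
  where "cycle_edges z l = {{z i, z (Suc i)} | i. 1 \<le> i \<and> i < l} \<union> {{z l, z 1}}"

end

theory Submission
  imports Defs
begin

text \<open>The symbolic power \<open>I\<^sup>(\<^sup>t\<^sup>)\<close> is spanned by the monomials whose weight on every minimal vertex cover
  is at least \<open>t\<close>, and all three claims follow from a decomposition of such a monomial \<open>M\<close>: it is divisible by
  \<open>e\<^sub>1 \<cdots> e\<^sub>a c\<^sub>1\<^sup>b c\<^sub>2\<^sup>c\<close> with edges \<open>e\<^sub>i\<close> and \<open>a + (n + 1) b + (m + 1) c = t\<close>. This divisor has degree
  \<open>2 t - (b + c)\<close>, and \<open>b\<close>, \<open>c\<close> vanish or are at most \<open>1\<close> for small \<open>t\<close>.

  Splitting the exponent of \<open>x\<^sub>1\<close> suitably between the two cycles reduces the decomposition to a single odd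
  cycle with vertex weights \<open>w\<close>. There one may lower \<open>w\<close> until the total weight is at most \<open>2 t\<close>; with
  \<open>b = 2 t - \<Sum> w\<close> and \<open>g\<^sub>i\<close> the excess over \<open>t\<close> of the weight of the cover
  \<open>{i, i + 1, i + 3, \<dots>, i + 2 n - 1}\<close>, one has \<open>w\<^sub>i = g\<^sub>i\<^sub>-\<^sub>1 + g\<^sub>i + b\<close>, so \<open>w\<close> is the sum of \<open>g\<^sub>i\<close> copies of
  each edge \<open>{i, i + 1}\<close> and \<open>b\<close> copies of the cycle.\<close>

subsection \<open>Localizations\<close>

text \<open>The obstacle behind the first claim is that symbolic powers involve the localizations at
  all associated primes. Every minimal cover C gives an associated prime P_C, and as P_C^t is
  P_C-primary, I^(t) lies in each P_C^t. Conversely, let p be any associated prime. The variables in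
  p form a minimal cover C, and each v in C has a neighbour outside p. These neighbours are units in
  R_p, so any t factors from C in a monomial can be completed to t edges.

  The constants n + 1 and m + 1 are the least sizes of a vertex cover of the two cycles. A copy of
  c1 has weight at least n + 1 on every cover, but its degree 2n + 1 is one less than that of n + 1
  edges; this deficit separates symbolic from ordinary powers. Lowering the total weight to at most
  2t makes b = 2t - \<Sum> w nonnegative, hence a possible number of copies.\<close>

locale localizable = cring R for R (structure) +
  fixes S
  assumes S_subset: "S \<subseteq> carrier R"
    and one_in_S: "\<one> \<in> S"
    and S_mult: "\<lbrakk>s \<in> S; u \<in> S\<rbrakk> \<Longrightarrow> s \<otimes> u \<in> S"
begin

lemma S_carrier [simp]: "s \<in> S \<Longrightarrow> s \<in> carrier R"
  using S_subset by auto

lemma equiv_frac_rel: "equiv (carrier R \<times> S) (frac_rel R S)"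
proof (rule equivI)
  show "frac_rel R S \<subseteq> (carrier R \<times> S) \<times> (carrier R \<times> S)"
    by (auto simp: frac_rel_def)
  show "refl_on (carrier R \<times> S) (frac_rel R S)"
    using one_in_S by (auto simp: refl_on_def frac_rel_def)
  show "sym (frac_rel R S)"
    unfolding sym_def frac_rel_def by (auto intro: sym)
  show "trans (frac_rel R S)"
  proof (rule transI)
    fix X Y Z assume 1: "(X, Y) \<in> frac_rel R S" and 2: "(Y, Z) \<in> frac_rel R S"
    obtain a s b u c v where X: "X = (a, s)" and Y: "Y = (b, u)" and Z: "Z = (c, v)"
      by (cases X, cases Y, cases Z) auto
    from 1 2 X Y Z obtain w w' where
      car: "a \<in> carrier R" "b \<in> carrier R" "c \<in> carrier R" "s \<in> S" "u \<in> S" "v \<in> S"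
        "w \<in> S" "w' \<in> S" and eq: "w \<otimes> (a \<otimes> u) = w \<otimes> (b \<otimes> s)" "w' \<otimes> (b \<otimes> v) = w' \<otimes> (c \<otimes> u)"
      by (auto simp: frac_rel_def)
    \<comment> \<open>The middle denominator \<open>u\<close> belongs to the multiplier: it
      completes \<open>a\<close> to the left side of the first equation and is released again, with
      \<open>c\<close>, by the second.\<close>
    have "(w \<otimes> w' \<otimes> u) \<otimes> (a \<otimes> v) = (w \<otimes> (a \<otimes> u)) \<otimes> (w' \<otimes> v)"
      using car by (simp add: m_ac)
    also have "\<dots> = (w' \<otimes> (b \<otimes> v)) \<otimes> (w \<otimes> s)"
      unfolding eq(1) using car by (simp add: m_ac)
    also have "\<dots> = (w \<otimes> w' \<otimes> u) \<otimes> (c \<otimes> s)"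
      unfolding eq(2) using car by (simp add: m_ac)
    finally show "(X, Z) \<in> frac_rel R S"
      using car X Z S_mult unfolding frac_rel_def by blast
  qed
qed

lemma frac_eq_iff:
  assumes "a \<in> carrier R" "b \<in> carrier R" "s \<in> S" "u \<in> S"
  shows "frac R S a s = frac R S b u \<longleftrightarrow> (\<exists>w \<in> S. w \<otimes> (a \<otimes> u) = w \<otimes> (b \<otimes> s))"
proof -
  have "frac R S a s = frac R S b u \<longleftrightarrow> ((a, s), (b, u)) \<in> frac_rel R S"
    unfolding frac_def using assms by (intro eq_equiv_class_iff[OF equiv_frac_rel]) simp_all
  with assms show ?thesis
    by (simp add: frac_rel_def)
qed

lemma frac_eqI:
  assumes "a \<in> carrier R" "b \<in> carrier R" "s \<in> S" "u \<in> S" "a \<otimes> u = b \<otimes> s"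
  shows "frac R S a s = frac R S b u"
  using assms one_in_S by (auto simp: frac_eq_iff)

lemma mem_frac: "\<lbrakk>a \<in> carrier R; s \<in> S\<rbrakk> \<Longrightarrow> (a, s) \<in> frac R S a s"
  unfolding frac_def using equiv_class_self[OF equiv_frac_rel] by auto

lemma mem_fracD:
  assumes "(b, u) \<in> frac R S a s"
  shows "b \<in> carrier R" "u \<in> S" "\<exists>w \<in> S. w \<otimes> (a \<otimes> u) = w \<otimes> (b \<otimes> s)"
  using assms by (auto simp: frac_def frac_rel_def)

text \<open>The unions in \<open>localization\<close> run over all representatives. Once the value
  is independent of them, the union is over a nonempty constant family, so each operation reduces to
  checking well-definedness.\<close>

lemma frac_binop:
  assumes "a \<in> carrier R" "s \<in> S" "b \<in> carrier R" "u \<in> S"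
    and "\<And>a' s' b' u'. \<lbrakk>(a', s') \<in> frac R S a s; (b', u') \<in> frac R S b u\<rbrakk> \<Longrightarrow> f a' s' b' u' = f a s b u"
  shows "(\<Union>(a', s') \<in> frac R S a s. \<Union>(b', u') \<in> frac R S b u. f a' s' b' u') = f a s b u"
proof -
  have "(\<Union>(a', s') \<in> frac R S a s. \<Union>(b', u') \<in> frac R S b u. f a' s' b' u')
      = (\<Union>X \<in> frac R S a s. \<Union>Y \<in> frac R S b u. f a s b u)"
    using assms(5) by (intro SUP_cong) auto
  then show ?thesis
    using mem_frac[OF assms(1,2)] mem_frac[OF assms(3,4)] by auto
qed

lemma frac_mult:
  assumes "a \<in> carrier R" "s \<in> S" "b \<in> carrier R" "u \<in> S"
  shows "frac R S a s \<otimes>\<^bsub>localization R S\<^esub> frac R S b u = frac R S (a \<otimes> b) (s \<otimes> u)"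
proof -
  have "frac R S (a' \<otimes> b') (s' \<otimes> u') = frac R S (a \<otimes> b) (s \<otimes> u)"
    if 1: "(a', s') \<in> frac R S a s" and 2: "(b', u') \<in> frac R S b u" for a' s' b' u'
  proof -
    note c = mem_fracD(1,2)[OF 1] mem_fracD(1,2)[OF 2] assms
    obtain w w' where w: "w \<in> S" "w' \<in> S" and eq: "w \<otimes> (a \<otimes> s') = w \<otimes> (a' \<otimes> s)"
        "w' \<otimes> (b \<otimes> u') = w' \<otimes> (b' \<otimes> u)"
      using mem_fracD(3)[OF 1] mem_fracD(3)[OF 2] by auto
    have "(w \<otimes> w') \<otimes> ((a' \<otimes> b') \<otimes> (s \<otimes> u)) = (w \<otimes> (a' \<otimes> s)) \<otimes> (w' \<otimes> (b' \<otimes> u))"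
      using c w by (simp add: m_ac)
    also have "\<dots> = (w \<otimes> w') \<otimes> ((a \<otimes> b) \<otimes> (s' \<otimes> u'))"
      unfolding eq[symmetric] using c w by (simp add: m_ac)
    finally show ?thesis
      using c w by (subst frac_eq_iff) (auto intro: S_mult)
  qed
  then show ?thesis
    using frac_binop[OF assms, of "\<lambda>a s b u. frac R S (a \<otimes> b) (s \<otimes> u)"]
    by (simp add: localization_def)
qed

lemma frac_add:
  assumes "a \<in> carrier R" "s \<in> S" "b \<in> carrier R" "u \<in> S"
  shows "frac R S a s \<oplus>\<^bsub>localization R S\<^esub> frac R S b u = frac R S ((a \<otimes> u) \<oplus> (b \<otimes> s)) (s \<otimes> u)"
proof -
  have "frac R S ((a' \<otimes> u') \<oplus> (b' \<otimes> s')) (s' \<otimes> u') = frac R S ((a \<otimes> u) \<oplus> (b \<otimes> s)) (s \<otimes> u)"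
    if 1: "(a', s') \<in> frac R S a s" and 2: "(b', u') \<in> frac R S b u" for a' s' b' u'
  proof -
    note c = mem_fracD(1,2)[OF 1] mem_fracD(1,2)[OF 2] assms
    obtain w w' where w: "w \<in> S" "w' \<in> S" and eq: "w \<otimes> (a \<otimes> s') = w \<otimes> (a' \<otimes> s)"
        "w' \<otimes> (b \<otimes> u') = w' \<otimes> (b' \<otimes> u)"
      using mem_fracD(3)[OF 1] mem_fracD(3)[OF 2] by auto
    have "(w \<otimes> w') \<otimes> (((a' \<otimes> u') \<oplus> (b' \<otimes> s')) \<otimes> (s \<otimes> u))
        = (w \<otimes> (a' \<otimes> s)) \<otimes> (w' \<otimes> (u' \<otimes> u)) \<oplus> (w' \<otimes> (b' \<otimes> u)) \<otimes> (w \<otimes> (s' \<otimes> s))"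
      using c w by (simp add: m_ac l_distr r_distr)
    also have "\<dots> = (w \<otimes> w') \<otimes> (((a \<otimes> u) \<oplus> (b \<otimes> s)) \<otimes> (s' \<otimes> u'))"
      unfolding eq[symmetric] using c w by (simp add: m_ac l_distr r_distr)
    finally show ?thesis
      using c w by (subst frac_eq_iff) (auto intro: S_mult)
  qed
  then show ?thesis
    using frac_binop[OF assms, of "\<lambda>a s b u. frac R S ((a \<otimes> u) \<oplus> (b \<otimes> s)) (s \<otimes> u)"]
    by (simp add: localization_def)
qed

lemma carrier_localization: "carrier (localization R S) = {frac R S a s |a s. a \<in> carrier R \<and> s \<in> S}"
  by (auto simp: localization_def quotient_def frac_def)

lemma frac_closed: "\<lbrakk>a \<in> carrier R; s \<in> S\<rbrakk> \<Longrightarrow> frac R S a s \<in> carrier (localization R S)"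
  by (auto simp: carrier_localization)

lemma zero_localization: "\<zero>\<^bsub>localization R S\<^esub> = frac R S \<zero> \<one>"
  and one_localization: "\<one>\<^bsub>localization R S\<^esub> = frac R S \<one> \<one>"
  by (simp_all add: localization_def)

lemma cring_localization: "cring (localization R S)"
proof (rule cringI)
  show "abelian_group (localization R S)"
  proof (rule abelian_groupI)
    fix X Y assume "X \<in> carrier (localization R S)" "Y \<in> carrier (localization R S)"
    then obtain a s b u where "X = frac R S a s" "Y = frac R S b u"
      "a \<in> carrier R" "b \<in> carrier R" "s \<in> S" "u \<in> S"
      by (auto simp: carrier_localization)
    then show "X \<oplus>\<^bsub>localization R S\<^esub> Y \<in> carrier (localization R S)"
      by (simp add: frac_add frac_closed S_mult)
  next
    show "\<zero>\<^bsub>localization R S\<^esub> \<in> carrier (localization R S)"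
      by (auto simp: zero_localization intro: frac_closed one_in_S)
  next
    fix X Y Z assume "X \<in> carrier (localization R S)" "Y \<in> carrier (localization R S)"
      "Z \<in> carrier (localization R S)"
    then obtain a s b u c v where *: "X = frac R S a s" "Y = frac R S b u" "Z = frac R S c v"
      "a \<in> carrier R" "b \<in> carrier R" "c \<in> carrier R" "s \<in> S" "u \<in> S" "v \<in> S"
      by (auto simp: carrier_localization)
    have "(a \<otimes> u \<oplus> b \<otimes> s) \<otimes> v \<oplus> c \<otimes> (s \<otimes> u) = a \<otimes> (u \<otimes> v) \<oplus> (b \<otimes> v \<oplus> c \<otimes> u) \<otimes> s"
      using * by (simp add: l_distr a_assoc m_assoc m_comm[of u s] m_comm[of u v] m_comm[of s v])
    with * show "X \<oplus>\<^bsub>localization R S\<^esub> Y \<oplus>\<^bsub>localization R S\<^esub> Z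
        = X \<oplus>\<^bsub>localization R S\<^esub> (Y \<oplus>\<^bsub>localization R S\<^esub> Z)"
      by (simp add: frac_add S_mult m_assoc)
  next
    fix X Y assume "X \<in> carrier (localization R S)" "Y \<in> carrier (localization R S)"
    then obtain a s b u where "X = frac R S a s" "Y = frac R S b u"
      "a \<in> carrier R" "b \<in> carrier R" "s \<in> S" "u \<in> S"
      by (auto simp: carrier_localization)
    then show "X \<oplus>\<^bsub>localization R S\<^esub> Y = Y \<oplus>\<^bsub>localization R S\<^esub> X"
      by (simp add: frac_add m_comm a_comm)
  next
    fix X assume "X \<in> carrier (localization R S)"
    then obtain a s where X: "X = frac R S a s" "a \<in> carrier R" "s \<in> S"
      by (auto simp: carrier_localization)
    then show "\<zero>\<^bsub>localization R S\<^esub> \<oplus>\<^bsub>localization R S\<^esub> X = X"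
      by (simp add: zero_localization frac_add one_in_S)
    have "frac R S (\<ominus> a) s \<oplus>\<^bsub>localization R S\<^esub> X = \<zero>\<^bsub>localization R S\<^esub>"
      using X by (simp add: zero_localization frac_add one_in_S)
        (rule frac_eqI, auto simp: S_mult one_in_S l_minus l_neg)
    with X show "\<exists>Y \<in> carrier (localization R S). Y \<oplus>\<^bsub>localization R S\<^esub> X = \<zero>\<^bsub>localization R S\<^esub>"
      by (intro bexI[of _ "frac R S (\<ominus> a) s"]) (auto intro: frac_closed)
  qed
next
  show "comm_monoid (localization R S)"
  proof (rule comm_monoidI)
    fix X Y assume "X \<in> carrier (localization R S)" "Y \<in> carrier (localization R S)"
    then obtain a s b u where "X = frac R S a s" "Y = frac R S b u"
      "a \<in> carrier R" "b \<in> carrier R" "s \<in> S" "u \<in> S"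
      by (auto simp: carrier_localization)
    then show "X \<otimes>\<^bsub>localization R S\<^esub> Y \<in> carrier (localization R S)"
      by (simp add: frac_mult frac_closed S_mult)
  next
    show "\<one>\<^bsub>localization R S\<^esub> \<in> carrier (localization R S)"
      by (auto simp: one_localization intro: frac_closed one_in_S)
  next
    fix X Y Z assume "X \<in> carrier (localization R S)" "Y \<in> carrier (localization R S)"
      "Z \<in> carrier (localization R S)"
    then show "X \<otimes>\<^bsub>localization R S\<^esub> Y \<otimes>\<^bsub>localization R S\<^esub> Z
        = X \<otimes>\<^bsub>localization R S\<^esub> (Y \<otimes>\<^bsub>localization R S\<^esub> Z)"
      by (auto simp: carrier_localization frac_mult S_mult m_assoc)
  next
    fix X assume "X \<in> carrier (localization R S)"
    then show "\<one>\<^bsub>localization R S\<^esub> \<otimes>\<^bsub>localization R S\<^esub> X = X"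
      by (auto simp: carrier_localization one_localization frac_mult one_in_S)
  next
    fix X Y assume "X \<in> carrier (localization R S)" "Y \<in> carrier (localization R S)"
    then show "X \<otimes>\<^bsub>localization R S\<^esub> Y = Y \<otimes>\<^bsub>localization R S\<^esub> X"
      by (auto simp: carrier_localization frac_mult m_comm)
  qed
next
  fix X Y Z assume "X \<in> carrier (localization R S)" "Y \<in> carrier (localization R S)"
    "Z \<in> carrier (localization R S)"
  then obtain a s b u c v where *: "X = frac R S a s" "Y = frac R S b u" "Z = frac R S c v"
    "a \<in> carrier R" "b \<in> carrier R" "c \<in> carrier R" "s \<in> S" "u \<in> S" "v \<in> S"
    by (auto simp: carrier_localization)
  show "(X \<oplus>\<^bsub>localization R S\<^esub> Y) \<otimes>\<^bsub>localization R S\<^esub> Z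
      = X \<otimes>\<^bsub>localization R S\<^esub> Z \<oplus>\<^bsub>localization R S\<^esub> Y \<otimes>\<^bsub>localization R S\<^esub> Z"
  proof -
    have "(a \<otimes> c) \<otimes> (u \<otimes> v) \<oplus> (b \<otimes> c) \<otimes> (s \<otimes> v) = (a \<otimes> u) \<otimes> (c \<otimes> v) \<oplus> (b \<otimes> s) \<otimes> (c \<otimes> v)"
      using * by (simp add: m_ac)
    also have "\<dots> = (a \<otimes> u \<oplus> b \<otimes> s) \<otimes> (c \<otimes> v)"
      using * by (simp add: l_distr)
    finally have "frac R S ((a \<otimes> u \<oplus> b \<otimes> s) \<otimes> c) (s \<otimes> u \<otimes> v)
        = frac R S ((a \<otimes> c) \<otimes> (u \<otimes> v) \<oplus> (b \<otimes> c) \<otimes> (s \<otimes> v)) ((s \<otimes> v) \<otimes> (u \<otimes> v))"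
      using * by (intro frac_eqI) (simp_all add: S_mult m_ac)
    then show ?thesis
      using * by (simp add: frac_add frac_mult S_mult)
  qed
qed

text \<open>A common denominator turns a sum of such fractions into one fraction with numerator
  still in \<open>J\<close>. This explicit ideal bounds the ideal generated by the image of
  \<open>J\<close> from above.\<close>

lemma ideal_localization:
  assumes "ideal J R"
  shows "ideal {frac R S a s |a s. a \<in> J \<and> s \<in> S} (localization R S)"
proof -
  interpret J: ideal J R by fact
  interpret L: cring "localization R S" by (rule cring_localization)
  let ?L = "{frac R S a s |a s. a \<in> J \<and> s \<in> S}"
  have sub: "?L \<subseteq> carrier (localization R S)"
    using J.Icarr by (auto intro: frac_closed)
  have mult: "X \<otimes>\<^bsub>localization R S\<^esub> Y \<in> ?L" if "X \<in> carrier (localization R S)" "Y \<in> ?L" for X Y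
  proof -
    from that obtain a s b u where *: "X = frac R S a s" "Y = frac R S b u" "a \<in> carrier R" "s \<in> S" "b \<in> J" "u \<in> S"
      by (auto simp: carrier_localization)
    then have "X \<otimes>\<^bsub>localization R S\<^esub> Y = frac R S (a \<otimes> b) (s \<otimes> u)"
      using J.Icarr by (simp add: frac_mult)
    then show ?thesis
      using * by (blast intro: S_mult J.I_l_closed)
  qed
  show ?thesis
  proof (rule idealI)
    show "ring (localization R S)" by (rule L.ring_axioms)
    show "subgroup ?L (add_monoid (localization R S))"
    proof (rule L.add.subgroupI)
      show "?L \<subseteq> carrier (localization R S)" by (fact sub)
      show "?L \<noteq> {}"
        using J.zero_closed one_in_S by blast
    next
      fix X assume X: "X \<in> ?L"
      with sub have "X \<in> carrier (localization R S)" by blast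
      then have "\<ominus>\<^bsub>localization R S\<^esub> X = (\<ominus>\<^bsub>localization R S\<^esub> \<one>\<^bsub>localization R S\<^esub>) \<otimes>\<^bsub>localization R S\<^esub> X"
        by (simp add: L.l_minus)
      also have "\<dots> \<in> ?L"
        using X by (intro mult) auto
      finally show "\<ominus>\<^bsub>localization R S\<^esub> X \<in> ?L" .
    next
      fix X Y assume "X \<in> ?L" "Y \<in> ?L"
      then obtain a s b u where *: "X = frac R S a s" "Y = frac R S b u" "a \<in> J" "s \<in> S" "b \<in> J" "u \<in> S"
        by auto
      then have "X \<oplus>\<^bsub>localization R S\<^esub> Y = frac R S ((a \<otimes> u) \<oplus> (b \<otimes> s)) (s \<otimes> u)"
        using J.Icarr by (simp add: frac_add)
      moreover have "(a \<otimes> u) \<oplus> (b \<otimes> s) \<in> J"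
        using * by (intro J.a_closed J.I_r_closed) auto
      ultimately show "X \<oplus>\<^bsub>localization R S\<^esub> Y \<in> ?L"
        using * by (blast intro: S_mult)
    qed
  next
    fix X Y assume "X \<in> ?L" "Y \<in> carrier (localization R S)"
    then show "Y \<otimes>\<^bsub>localization R S\<^esub> X \<in> ?L" by (rule mult[rotated])
    moreover have "X \<otimes>\<^bsub>localization R S\<^esub> Y = Y \<otimes>\<^bsub>localization R S\<^esub> X"
      using \<open>X \<in> ?L\<close> \<open>Y \<in> carrier (localization R S)\<close> sub by (intro L.m_comm) auto
    ultimately show "X \<otimes>\<^bsub>localization R S\<^esub> Y \<in> ?L" by simp
  qed
qed

text \<open>If \<open>f/1 = a/s\<close> with \<open>a\<close> in \<open>J\<close>, clearing
  denominators gives \<open>w s f = w a\<close>, an element of \<open>J\<close>. Conversely,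
  \<open>f/1\<close> is the product of \<open>1/s\<close> and \<open>(s f)/1\<close>.\<close>

lemma frac_one_mem_extension_iff:
  assumes "ideal J R" "f \<in> carrier R"
  shows "frac R S f \<one> \<in> Idl\<^bsub>localization R S\<^esub> ((\<lambda>g. frac R S g \<one>) ` J) \<longleftrightarrow> (\<exists>s \<in> S. s \<otimes> f \<in> J)"
proof
  interpret J: ideal J R by fact
  interpret L: cring "localization R S" by (rule cring_localization)
  let ?L = "{frac R S a s |a s. a \<in> J \<and> s \<in> S}"
  let ?G = "(\<lambda>g. frac R S g \<one>) ` J"
  {
    assume "frac R S f \<one> \<in> Idl\<^bsub>localization R S\<^esub> ?G"
    moreover have "Idl\<^bsub>localization R S\<^esub> ?G \<subseteq> ?L"
      using one_in_S by (intro L.genideal_minimal ideal_localization assms) blast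
    ultimately obtain a s where a: "a \<in> J" "s \<in> S" "frac R S f \<one> = frac R S a s"
      by auto
    then obtain w where w: "w \<in> S" "w \<otimes> (f \<otimes> s) = w \<otimes> (a \<otimes> \<one>)"
      using assms J.Icarr one_in_S by (auto simp: frac_eq_iff)
    have "(w \<otimes> s) \<otimes> f = w \<otimes> a"
      using w a assms J.Icarr by (simp add: m_ac)
    then show "\<exists>s \<in> S. s \<otimes> f \<in> J"
      using w a J.I_l_closed[of a w] S_mult[of w s] by (auto intro!: bexI[of _ "w \<otimes> s"])
  next
    assume "\<exists>s \<in> S. s \<otimes> f \<in> J"
    then obtain s where s: "s \<in> S" "s \<otimes> f \<in> J" by auto
    have "?G \<subseteq> carrier (localization R S)"
      using J.Icarr one_in_S by (auto intro: frac_closed)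
    then interpret I: ideal "Idl\<^bsub>localization R S\<^esub> ?G" "localization R S"
      by (rule L.genideal_ideal)
    have "frac R S (s \<otimes> f) \<one> \<in> Idl\<^bsub>localization R S\<^esub> ?G"
      using s L.genideal_self[OF \<open>?G \<subseteq> carrier (localization R S)\<close>] by auto
    then have "frac R S \<one> s \<otimes>\<^bsub>localization R S\<^esub> frac R S (s \<otimes> f) \<one> \<in> Idl\<^bsub>localization R S\<^esub> ?G"
      using s by (intro I.I_l_closed frac_closed) auto
    also have "frac R S \<one> s \<otimes>\<^bsub>localization R S\<^esub> frac R S (s \<otimes> f) \<one> = frac R S f \<one>"
      using s assms one_in_S by (simp add: frac_mult) (rule frac_eqI, auto simp: m_ac)
    finally show "frac R S f \<one> \<in> Idl\<^bsub>localization R S\<^esub> ?G" .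
  }
qed

end

text \<open>This removes fractions from the rest of the argument: a contraction is tested by a
  single multiplier outside \<open>p\<close>.\<close>

lemma (in cring) mem_local_contraction_iff:
  assumes "primeideal p R" "ideal J R"
  shows "f \<in> local_contraction R p J \<longleftrightarrow> f \<in> carrier R \<and> (\<exists>s \<in> carrier R - p. s \<otimes> f \<in> J)"
proof -
  interpret p: primeideal p R by fact
  interpret localizable R "carrier R - p"
    using p.I_prime p.I_notcarr p.one_imp_carrier by unfold_locales auto
  show ?thesis
    using frac_one_mem_extension_iff[OF assms(2)] by (auto simp: local_contraction_def)
qed

subsection \<open>Weighted vertex covers\<close>

text \<open>Uncrossing, by induction on the family. Adding \<open>C\<close> gains the weight of
  \<open>C - ?U\<close> in the union and loses that of \<open>?X - C\<close> in the intersection.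
  The set \<open>(C \<union> ?X) \<inter> ?U\<close> is again a cover, and its weight is
  \<open>t\<close> minus the gain plus the loss; since this is at least \<open>t\<close>, the gain
  does not exceed the loss.\<close>

lemma tight_covers_Union_Inter:
  fixes w :: "'v \<Rightarrow> nat"
  assumes "finite V" and pairs: "\<And>e. e \<in> E \<Longrightarrow> \<exists>a b. e = {a, b}"
    and cover: "\<And>C. vertex_cover V E C \<Longrightarrow> t \<le> sum w C"
    and "finite G" "G \<noteq> {}"
    and "\<And>C. C \<in> G \<Longrightarrow> vertex_cover V E C \<and> sum w C = t"
  shows "sum w (\<Union>G) + sum w (\<Inter>G) \<le> 2 * t"
  using assms(4-6)
proof (induction rule: finite_ne_induct)
  case (singleton C)
  then show ?case by simp
next
  case (insert C F)
  let ?U = "\<Union>F" and ?X = "\<Inter>F"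
  have IH: "sum w ?U + sum w ?X \<le> 2 * t"
    using insert by auto
  have XU: "?X \<subseteq> ?U"
    using insert by auto
  have UV: "?U \<subseteq> V" and CV: "C \<subseteq> V"
    using insert.prems by (auto simp: vertex_cover_def)
  have fin: "finite ?U" "finite C" "finite ?X"
    using UV CV XU \<open>finite V\<close> by (meson finite_subset)+
  have "vertex_cover V E ((C \<union> ?X) \<inter> ?U)"
    unfolding vertex_cover_def
  proof (intro conjI ballI notI)
    show "(C \<union> ?X) \<inter> ?U \<subseteq> V" using UV by auto
  next
    fix e assume e: "e \<in> E" "e \<inter> ((C \<union> ?X) \<inter> ?U) = {}"
    obtain a b where ab: "e = {a, b}" using pairs e by blast
    have hit: "e \<inter> D \<noteq> {}" if "D \<in> insert C F" for D
      using insert.prems[OF that] e(1) by (simp add: vertex_cover_def)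
    \<comment> \<open>If an end \<open>p\<close> of the missed edge is in \<open>C\<close>, it lies
      outside \<open>?U\<close>, so every cover in \<open>F\<close> meets the edge in
      \<open>q\<close>. Then \<open>q\<close> is in \<open>?X\<close>, hence in the set that was to
      miss the edge.\<close>
    have no: False if "p \<in> C" "e = {p, q}" for p q
    proof -
      have "p \<notin> ?U" using e(2) that by blast
      then have "q \<in> ?X" using hit that(2) by blast
      then show False using e(2) that(2) XU by blast
    qed
    have "a \<in> C \<or> b \<in> C" using hit[of C] ab by blast
    then show False using no[of a b] no[of b a] ab by (auto simp: insert_commute)
  qed
  then have "t \<le> sum w ((C \<union> ?X) \<inter> ?U)" by (rule cover)
  also have "(C \<union> ?X) \<inter> ?U = (C \<inter> ?U) \<union> (?X - C)" using XU by auto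
  also have "sum w \<dots> = sum w (C \<inter> ?U) + sum w (?X - C)"
    using fin by (intro sum.union_disjoint) auto
  finally have "t \<le> sum w (C \<inter> ?U) + sum w (?X - C)" .
  moreover have "t = sum w (C \<inter> ?U) + sum w (C - ?U)"
    using insert.prems[of C] fin by (simp add: sum.Int_Diff[of C w ?U])
  moreover have "sum w (\<Union>(insert C F)) = sum w ?U + sum w (C - ?U)"
    using fin by (subst sum.union_disjoint[symmetric]) (auto intro: sum.cong)
  moreover have "sum w ?X = sum w (\<Inter>(insert C F)) + sum w (?X - C)"
    using fin by (subst sum.Int_Diff[of ?X w C]) (auto simp: Int_commute)
  ultimately show ?case using IH by linarith
qed

text \<open>If no weight can be lowered any further, then every vertex of positive weight lies in a tight cover, so
  the total weight is that of the union of all tight covers.\<close>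

lemma reduce_cover_weight:
  fixes w :: "'v \<Rightarrow> nat"
  assumes "finite V" and pairs: "\<And>e. e \<in> E \<Longrightarrow> \<exists>a b. e = {a, b}"
    and "\<And>C. vertex_cover V E C \<Longrightarrow> t \<le> sum w C"
  shows "\<exists>w'. (\<forall>v. w' v \<le> w v) \<and> (\<forall>C. vertex_cover V E C \<longrightarrow> t \<le> sum w' C) \<and> sum w' V \<le> 2 * t"
  using assms(3)
proof (induction "sum w V" arbitrary: w rule: less_induct)
  case less
  show ?case
  proof (cases "\<exists>v \<in> V. 0 < w v \<and> (\<forall>C. vertex_cover V E C \<longrightarrow> t \<le> sum (w(v := w v - 1)) C)")
    case True
    then obtain v where v: "v \<in> V" "0 < w v"
      and cov: "\<And>C. vertex_cover V E C \<Longrightarrow> t \<le> sum (w(v := w v - 1)) C" by blast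
    have "sum (w(v := w v - 1)) V < sum w V"
      using v \<open>finite V\<close> by (intro sum_strict_mono_ex1) auto
    then obtain w' where w': "\<forall>x. w' x \<le> (w(v := w v - 1)) x"
      "\<forall>C. vertex_cover V E C \<longrightarrow> t \<le> sum w' C" "sum w' V \<le> 2 * t"
      using less.hyps cov by blast
    have "w' x \<le> w x" for x
      using w'(1)[rule_format, of x] by (auto split: if_splits)
    with w' show ?thesis by blast
  next
    case False
    let ?G = "{C. vertex_cover V E C \<and> sum w C = t}"
    have in_tight: "v \<in> \<Union>?G" if v: "v \<in> V" "0 < w v" for v
    proof -
      \<comment> \<open>Lowering one weight by 1 lowers a cover by at most 1, so a cover that falls
        below \<open>t\<close> was tight and contains \<open>v\<close>.\<close>
      obtain C where C: "vertex_cover V E C" "sum (w(v := w v - 1)) C < t"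
        using False v by (meson not_le)
      have "finite C"
        using C \<open>finite V\<close> by (auto simp: vertex_cover_def intro: finite_subset)
      have t: "t \<le> sum w C" using less.prems C by blast
      have vC: "v \<in> C"
      proof (rule ccontr)
        assume "v \<notin> C"
        then have "sum (w(v := w v - 1)) C = sum w C" by (intro sum.cong) auto
        with C t show False by simp
      qed
      have "sum (w(v := w v - 1)) C = w v - 1 + sum w (C - {v})"
        using vC \<open>finite C\<close> by (subst sum.remove[of C v]) (auto intro: sum.cong)
      moreover have "sum w C = w v + sum w (C - {v})"
        using vC \<open>finite C\<close> by (rule sum.remove[rotated])
      ultimately show ?thesis using C t vC v by auto
    qed
    have "sum w V \<le> 2 * t"
    proof (cases "?G = {}")
      case True
      then show ?thesis using in_tight by (metis Union_empty emptyE gr0I le0 sum.neutral)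
    next
      case nonempty: False
      have GV: "?G \<subseteq> Pow V" by (auto simp: vertex_cover_def)
      then have "finite ?G" using \<open>finite V\<close> by (simp add: finite_subset)
      have "sum w V = sum w (\<Union>?G)"
        using in_tight GV \<open>finite V\<close> by (intro sum.mono_neutral_right) auto
      moreover have "sum w (\<Union>?G) + sum w (\<Inter>?G) \<le> 2 * t"
        by (rule tight_covers_Union_Inter[OF \<open>finite V\<close> pairs less.prems \<open>finite ?G\<close> nonempty]) auto
      ultimately show ?thesis by simp
    qed
    with less.prems show ?thesis by (intro exI[of _ w]) auto
  qed
qed

section \<open>Decomposing weights on an odd cycle\<close>

lemma sum_shift_periodic:
  fixes F :: "nat \<Rightarrow> 'a::comm_monoid_add"
  assumes "\<And>i. F (i + N) = F i"
  shows "(\<Sum>i<N. F (Suc i)) = (\<Sum>i<N. F i)"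
proof (cases N)
  case (Suc M)
  then show ?thesis
    using assms[of 0] sum.lessThan_Suc_shift[of F M] by (simp add: add.commute)
qed simp

lemma sum_even_odd:
  fixes f :: "nat \<Rightarrow> 'a::comm_monoid_add"
  shows "(\<Sum>j<2*n. f j) = (\<Sum>j<n. f (2*j)) + (\<Sum>j<n. f (2*j+1))"
  by (induction n) (simp_all add: algebra_simps)

text \<open>Here \<open>u\<close> lists the weights round the cycle periodically. Two consecutive
  excesses recover the weight of the vertex that the two covers share, and summing this over one
  period gives the count. The assumptions \<open>W\<close> and \<open>le\<close> make the natural
  subtractions in \<open>g\<close> and \<open>b\<close> exact.\<close>

lemma alternating_cover_sums:
  fixes u :: "nat \<Rightarrow> nat"
  assumes per: "\<And>i. u (i + (2*n+1)) = u i"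
    and W: "\<And>i. t \<le> u i + (\<Sum>j<n. u (i+1+2*j))"
    and le: "(\<Sum>i<2*n+1. u i) \<le> 2 * t"
  defines "b \<equiv> 2 * t - (\<Sum>i<2*n+1. u i)"
    and "g \<equiv> \<lambda>i. u i + (\<Sum>j<n. u (i+1+2*j)) - t"
  shows "g i + g (Suc i) + b = u (Suc i)"
    and "(\<Sum>i<2*n+1. g i) + (n+1) * b = t"
proof -
  let ?W = "\<lambda>i. u i + (\<Sum>j<n. u (i+1+2*j))"
  have tot: "(\<Sum>j<2*n+1. u (i+j)) = (\<Sum>j<2*n+1. u j)" for i
  proof (induction i)
    case (Suc i)
    have "(\<Sum>j<2*n+1. u (Suc i+j)) = (\<Sum>j<2*n+1. u (i+j))"
      using sum_shift_periodic[of "\<lambda>j. u (i + j)" "2*n+1"] per[of "i + _"]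
      by (simp add: add.assoc)
    with Suc show ?case by simp
  qed simp
  \<comment> \<open>The covers starting at \<open>i\<close> and at \<open>Suc i\<close> together
    contain every position once and \<open>Suc i\<close> twice.\<close>
  have WW: "?W i + ?W (Suc i) = u (Suc i) + (\<Sum>j<2*n+1. u j)" for i
  proof -
    have "(\<Sum>j<2*n+1. u j) = u i + (\<Sum>j<2*n. u (i+1+j))"
      unfolding tot[of i, symmetric] using sum.lessThan_Suc_shift[of "\<lambda>j. u (i+j)" "2*n"] by simp
    also have "\<dots> = u i + ((\<Sum>j<n. u (i+1+2*j)) + (\<Sum>j<n. u (Suc i+1+2*j)))"
      unfolding sum_even_odd by (simp add: add.assoc)
    finally show ?thesis by simp
  qed
  have g: "g i + t = ?W i" for i
    using W[of i] by (simp add: g_def)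
  have b: "b + (\<Sum>i<2*n+1. u i) = 2 * t"
    using le by (simp add: b_def)
  show eq: "g i + g (Suc i) + b = u (Suc i)" for i
    using WW[of i] g[of i] g[of "Suc i"] b by linarith
  have gper: "g (i + (2*n+1)) = g i" for i
  proof -
    have "u (i + (2*n+1) + 1 + 2*j) = u (i+1+2*j)" for j
      using per[of "i+1+2*j"] by (simp add: algebra_simps)
    then show ?thesis using per[of i] by (simp add: g_def)
  qed
  have "(\<Sum>i<2*n+1. g i + g (Suc i) + b) = (\<Sum>i<2*n+1. u (Suc i))"
    unfolding eq ..
  then have "2 * (\<Sum>i<2*n+1. g i) + (2*n+1) * b = (\<Sum>i<2*n+1. u i)"
    using sum_shift_periodic[of u "2*n+1", OF per] sum_shift_periodic[of g "2*n+1", OF gper]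
    by (simp only: sum.distrib sum_constant card_lessThan mult_2 of_nat_id)
  \<comment> \<open>The sum of \<open>u\<close> is \<open>2 * t - b\<close>, and moving this
    \<open>b\<close> to the left raises its coefficient from \<open>2*n+1\<close> to
    \<open>2*n+2\<close>.\<close>
  then have "2 * ((\<Sum>i<2*n+1. g i) + (n+1) * b) = 2 * t"
    using b by (simp add: algebra_simps del: sum.lessThan_Suc)
  then show "(\<Sum>i<2*n+1. g i) + (n+1) * b = t" by simp
qed

text \<open>These are the exponent vectors of the monomial generators of the \<open>a\<close>-th
  power of the edge ideal; edges may be repeated.\<close>

primrec edge_sums :: "'v set set \<Rightarrow> nat \<Rightarrow> ('v \<Rightarrow>\<^sub>0 nat) set"
  where
    "edge_sums E 0 = {0}"
  | "edge_sums E (Suc a) =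
      {s + (Poly_Mapping.single u 1 + Poly_Mapping.single v 1) |s u v. s \<in> edge_sums E a \<and> {u, v} \<in> E}"

lemma edge_sums_mono:
  assumes "E \<subseteq> E'"
  shows "edge_sums E a \<subseteq> edge_sums E' a"
  using assms by (induction a) fastforce+

lemma edge_sums_add:
  assumes "s \<in> edge_sums E a" "s' \<in> edge_sums E b"
  shows "s + s' \<in> edge_sums E (a + b)"
  using assms(2)
proof (induction b arbitrary: s')
  case 0
  then show ?case using assms by simp
next
  case (Suc b)
  then obtain s1 u v where s': "s' = s1 + (Poly_Mapping.single u 1 + Poly_Mapping.single v 1)"
    "s1 \<in> edge_sums E b" "{u, v} \<in> E"
    by auto
  have "s + s' = (s + s1) + (Poly_Mapping.single u 1 + Poly_Mapping.single v 1)"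
    using s' by (simp add: add.assoc)
  then show ?case using Suc.IH[OF s'(2)] s'(3) by auto
qed

lemma edge_sums_sum:
  assumes "finite A" "\<And>i. i \<in> A \<Longrightarrow> f i \<in> edge_sums E (k i)"
  shows "sum f A \<in> edge_sums E (sum k A)"
  using assms by (induction) (auto intro: edge_sums_add)

lemma edge_sums_multiple:
  assumes "{u, v} \<in> E"
  shows "Poly_Mapping.single u k + Poly_Mapping.single v k \<in> edge_sums E k"
proof (induction k)
  case (Suc k)
  have "Poly_Mapping.single u (Suc k) + Poly_Mapping.single v (Suc k)
      = (Poly_Mapping.single u k + Poly_Mapping.single v k)
        + (Poly_Mapping.single u 1 + Poly_Mapping.single v (1::nat))"
    using single_add[of u k 1] single_add[of v k 1] by (simp add: ac_simps)
  with Suc assms show ?case by auto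
qed simp

text \<open>The exponent vector of the \<open>b\<close>-th power of the product of all variables on
  the cycle.\<close>

definition cycle_exp :: "(nat \<Rightarrow> 'v) \<Rightarrow> nat \<Rightarrow> nat \<Rightarrow> ('v \<Rightarrow>\<^sub>0 nat)"
  where "cycle_exp z l b = (\<Sum>i=1..l. Poly_Mapping.single (z i) b)"

text \<open>Residues make the closing edge look like every other edge, so that sums round the cycle
  can be shifted periodically.\<close>

lemma cycle_edges_mod:
  assumes "0 < l"
  shows "cycle_edges z l = range (\<lambda>i. {z (i mod l + 1), z (Suc i mod l + 1)})"
proof
  show "cycle_edges z l \<subseteq> range (\<lambda>i. {z (i mod l + 1), z (Suc i mod l + 1)})"
  proof
    fix e assume "e \<in> cycle_edges z l"
    then consider i where "e = {z i, z (Suc i)}" "1 \<le> i" "i < l" | "e = {z l, z 1}"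
      by (auto simp: cycle_edges_def)
    then show "e \<in> range (\<lambda>i. {z (i mod l + 1), z (Suc i mod l + 1)})"
    proof cases
      case 1
      then show ?thesis by (intro image_eqI[of _ _ "i - 1"]) auto
    next
      case 2
      then show ?thesis using assms by (intro image_eqI[of _ _ "l - 1"]) auto
    qed
  qed
  show "range (\<lambda>i. {z (i mod l + 1), z (Suc i mod l + 1)}) \<subseteq> cycle_edges z l"
  proof safe
    fix i
    have "i mod l < l" using assms by simp
    show "{z (i mod l + 1), z (Suc i mod l + 1)} \<in> cycle_edges z l"
    proof (cases "Suc (i mod l) = l")
      case True
      then have "i mod l + 1 = l" "Suc i mod l + 1 = 1" by (simp_all add: mod_Suc)
      then have "{z (i mod l + 1), z (Suc i mod l + 1)} = {z l, z 1}" by (simp only:)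
      then show ?thesis by (simp add: cycle_edges_def)
    next
      case False
      then have eq: "Suc i mod l + 1 = Suc (i mod l + 1)" by (simp add: mod_Suc)
      have "1 \<le> i mod l + 1 \<and> i mod l + 1 < l" using False \<open>i mod l < l\<close> by simp
      then show ?thesis
        unfolding cycle_edges_def eq by (intro UnI1 CollectI exI[of _ "i mod l + 1"] conjI refl) simp_all
    qed
  qed
qed

text \<open>Going round from \<open>i + 1\<close>, every second vertex is taken. As the length is
  odd, the walk stops one vertex short of \<open>i\<close>, and adding \<open>i\<close> covers the
  last two edges.\<close>

lemma odd_cycle_cover:
  fixes z :: "nat \<Rightarrow> 'v" and n i :: nat
  defines "\<zeta> \<equiv> \<lambda>i. z (i mod (2*n+1) + 1)"
  shows "vertex_cover (z ` {1..2*n+1}) (cycle_edges z (2*n+1))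
    (insert (\<zeta> i) ((\<lambda>j. \<zeta> (i+1+2*j)) ` {..<n}))" (is "vertex_cover _ _ ?K")
  unfolding vertex_cover_def
proof (intro conjI ballI)
  have "\<zeta> k \<in> z ` {1..2*n+1}" for k
    unfolding \<zeta>_def using mod_less_divisor[of "2*n+1" k] by (intro imageI) (auto simp: less_Suc_eq_le)
  then show "?K \<subseteq> z ` {1..2*n+1}" by auto
next
  fix e assume "e \<in> cycle_edges z (2*n+1)"
  then obtain k where e: "e = {\<zeta> k, \<zeta> (Suc k)}"
    by (auto simp: cycle_edges_mod \<zeta>_def)
  \<comment> \<open>\<open>d\<close> counts the steps from \<open>i\<close> to \<open>k\<close>
    round the cycle; adding \<open>2*n+1\<close> first keeps the difference natural. Its parity
    decides which end of the edge is in the cover, and for \<open>d = 2*n\<close> the second end is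
    \<open>i\<close> again.\<close>
  define d where "d = (k + (2*n+1 - i mod (2*n+1))) mod (2*n+1)"
  have d: "d < 2*n+1" by (simp add: d_def)
  have "(i + d) mod (2*n+1) = (i mod (2*n+1) + (k + (2*n+1 - i mod (2*n+1)))) mod (2*n+1)"
    unfolding d_def by (simp add: mod_simps)
  also have "i mod (2*n+1) + (k + (2*n+1 - i mod (2*n+1))) = k + (2*n+1)"
    using mod_less_divisor[of "2*n+1" i] by linarith
  finally have id: "(i + d) mod (2*n+1) = k mod (2*n+1)" by (simp only: mod_add_self2)
  then have 1: "\<zeta> (i + d) = \<zeta> k" by (simp add: \<zeta>_def)
  have 2: "\<zeta> (i + Suc d) = \<zeta> (Suc k)"
    using id unfolding \<zeta>_def by (metis add_Suc_right mod_Suc_eq)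
  consider "d = 0" | "odd d" | "even d" "0 < d" "d < 2*n" | "d = 2*n"
    using d by linarith
  then show "e \<inter> ?K \<noteq> {}"
  proof cases
    case 1
    then show ?thesis using \<open>\<zeta> (i + d) = \<zeta> k\<close> e by auto
  next
    case 2
    then obtain j where "d = 2*j+1" by (elim oddE)
    then have "\<zeta> k = \<zeta> (i+1+2*j)" "j < n" using 1 d by (simp_all add: algebra_simps)
    then show ?thesis using e by auto
  next
    case 3
    then obtain j where "d = 2*j" by (elim evenE)
    then have "\<zeta> (Suc k) = \<zeta> (i+1+2*j)" "j < n" using 2 3 by (simp_all add: algebra_simps)
    then show ?thesis using e by auto
  next
    case 4
    then have "\<zeta> (Suc k) = \<zeta> (i + (2*n+1))" using 2 by simp
    also have "\<dots> = \<zeta> i" by (simp only: \<zeta>_def mod_add_self2)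
    finally have "\<zeta> (Suc k) = \<zeta> i" .
    then show ?thesis using e by auto
  qed
qed

text \<open>The bound is 0 off the cycle so that the decompositions of two cycles can be added, with
  only their common vertex to be watched.\<close>

lemma odd_cycle_decomposition:
  fixes z :: "nat \<Rightarrow> 'v" and w :: "'v \<Rightarrow> nat"
  assumes inj: "inj_on z {1..2*n+1}"
    and cover: "\<And>C. vertex_cover (z ` {1..2*n+1}) (cycle_edges z (2*n+1)) C \<Longrightarrow> t \<le> sum w C"
  shows "\<exists>a b s. s \<in> edge_sums (cycle_edges z (2*n+1)) a \<and> a + (n+1) * b = t \<and>
    (\<forall>v. Poly_Mapping.lookup (s + cycle_exp z (2*n+1) b) v
        \<le> (if v \<in> z ` {1..2*n+1} then w v else 0))"
proof -
  let ?N = "2*n+1" and ?E = "cycle_edges z (2*n+1)" and ?V = "z ` {1..2*n+1}"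
  define \<zeta> where "\<zeta> = (\<lambda>i. z (i mod ?N + 1))"
  have \<zeta>_per: "\<zeta> (i + ?N) = \<zeta> i" for i
    unfolding \<zeta>_def by (simp only: mod_add_self2)
  have pairs: "\<exists>a b. e = {a, b}" if "e \<in> ?E" for e
    using that by (auto simp: cycle_edges_def)
  obtain w' where w': "\<And>v. w' v \<le> w v" "\<And>C. vertex_cover ?V ?E C \<Longrightarrow> t \<le> sum w' C"
      "sum w' ?V \<le> 2 * t"
    using reduce_cover_weight[of ?V ?E t w, OF _ pairs cover] by auto
  define u where "u = (\<lambda>i. w' (\<zeta> i))"
  have over_V: "(\<Sum>i<?N. f (\<zeta> i)) = (\<Sum>v \<in> ?V. f v)" for f :: "'v \<Rightarrow> 'a::comm_monoid_add"
  proof -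
    have "(\<Sum>i<?N. f (\<zeta> i)) = (\<Sum>i<?N. f (z (Suc i)))"
      unfolding \<zeta>_def by (intro sum.cong) auto
    also have "\<dots> = (\<Sum>i=1..?N. f (z i))"
      by (rule sum.reindex_bij_witness[of _ "\<lambda>i. i - 1" Suc]) auto
    also have "\<dots> = (\<Sum>v \<in> ?V. f v)"
      using inj by (simp only: sum.reindex o_def)
    finally show ?thesis .
  qed
  have W: "t \<le> u i + (\<Sum>j<n. u (i+1+2*j))" for i
  proof -
    let ?f = "\<lambda>j. \<zeta> (i+1+2*j)"
    have "t \<le> sum w' (insert (\<zeta> i) (?f ` {..<n}))"
      using w'(2) odd_cycle_cover[of z n i] unfolding \<zeta>_def by blast
    also have "\<dots> \<le> w' (\<zeta> i) + sum w' (?f ` {..<n})"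
      by (cases "\<zeta> i \<in> ?f ` {..<n}") (auto simp: insert_absorb)
    also have "sum w' (?f ` {..<n}) \<le> (\<Sum>j<n. w' (?f j))"
      using sum_image_le[of "{..<n}" w' ?f] by (simp add: o_def)
    finally show ?thesis by (simp add: u_def)
  qed
  have le: "(\<Sum>i<?N. u i) \<le> 2 * t"
    using w'(3) over_V[of w'] by (simp add: u_def)
  define b where "b = 2 * t - (\<Sum>i<?N. u i)"
  define g where "g = (\<lambda>i. u i + (\<Sum>j<n. u (i+1+2*j)) - t)"
  have u_per: "u (i + ?N) = u i" for i
    by (simp only: u_def \<zeta>_per)
  have g: "g i + g (Suc i) + b = u (Suc i)" "(\<Sum>i<?N. g i) + (n+1) * b = t" for i
    unfolding b_def g_def by (rule alternating_cover_sums[OF u_per W le])+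
  have g_per: "g (i + ?N) = g i" for i
  proof -
    have "u (i + ?N + 1 + 2*j) = u (i+1+2*j)" for j
      using u_per[of "i+1+2*j"] by (simp add: algebra_simps)
    then show ?thesis using u_per[of i] by (simp add: g_def)
  qed
  define s where "s = (\<Sum>i<?N. Poly_Mapping.single (\<zeta> i) (g i) + Poly_Mapping.single (\<zeta> (Suc i)) (g i))"
  have "s \<in> edge_sums ?E (\<Sum>i<?N. g i)"
    unfolding s_def
  proof (intro edge_sums_sum edge_sums_multiple)
    show "{\<zeta> i, \<zeta> (Suc i)} \<in> ?E" for i
      by (auto simp: cycle_edges_mod \<zeta>_def)
  qed simp
  moreover have "Poly_Mapping.lookup (s + cycle_exp z ?N b) v \<le> (if v \<in> ?V then w v else 0)" for v
  proof -
    have "cycle_exp z ?N b = (\<Sum>v \<in> ?V. Poly_Mapping.single v b)"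
      unfolding cycle_exp_def using inj by (simp only: sum.reindex o_def)
    also have "\<dots> = (\<Sum>i<?N. Poly_Mapping.single (\<zeta> i) b)"
      by (rule over_V[symmetric])
    also have "\<dots> = (\<Sum>i<?N. Poly_Mapping.single (\<zeta> (Suc i)) b)"
      by (rule sum_shift_periodic[symmetric]) (simp only: \<zeta>_per)
    finally have "s + cycle_exp z ?N b = (\<Sum>i<?N. Poly_Mapping.single (\<zeta> i) (g i))
        + (\<Sum>i<?N. Poly_Mapping.single (\<zeta> (Suc i)) (g i)) + (\<Sum>i<?N. Poly_Mapping.single (\<zeta> (Suc i)) b)"
      unfolding s_def sum.distrib by simp
    \<comment> \<open>All sums are shifted to the vertex \<open>\<zeta> (Suc i)\<close>, to which
      the edges on its two sides contribute \<open>g i\<close> and \<open>g (Suc i)\<close>.\<close>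
    also have "(\<Sum>i<?N. Poly_Mapping.single (\<zeta> i) (g i))
        = (\<Sum>i<?N. Poly_Mapping.single (\<zeta> (Suc i)) (g (Suc i)))"
      by (rule sum_shift_periodic[symmetric]) (simp only: \<zeta>_per g_per)
    also have "\<dots> + (\<Sum>i<?N. Poly_Mapping.single (\<zeta> (Suc i)) (g i)) + (\<Sum>i<?N. Poly_Mapping.single (\<zeta> (Suc i)) b)
        = (\<Sum>i<?N. Poly_Mapping.single (\<zeta> (Suc i)) (g i + g (Suc i) + b))"
      unfolding single_add sum.distrib by (simp only: ac_simps)
    also have "\<dots> = (\<Sum>i<?N. Poly_Mapping.single (\<zeta> (Suc i)) (u (Suc i)))"
      unfolding g(1) ..
    also have "\<dots> = (\<Sum>i<?N. Poly_Mapping.single (\<zeta> i) (u i))"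
      by (rule sum_shift_periodic) (simp only: \<zeta>_per u_per)
    also have "\<dots> = (\<Sum>v \<in> ?V. Poly_Mapping.single v (w' v))"
      unfolding u_def by (rule over_V)
    finally have "Poly_Mapping.lookup (s + cycle_exp z ?N b) v = (if v \<in> ?V then w' v else 0)"
      by (simp add: lookup_sum lookup_single when_def sum.delta' del: image_iff)
    then show ?thesis using w'(1) by simp
  qed
  ultimately show ?thesis using g(2) by blast
qed

section \<open>Splitting a weight at the common vertex of two graphs\<close>

text \<open>For one side, let \<open>a\<close> be the least weight of a cover not counting
  \<open>r\<close>, and \<open>b\<close> the least weight of a cover avoiding \<open>r\<close>. If
  \<open>r\<close> receives a weight \<open>k\<close> of at most \<open>b - a\<close>, every cover
  of that side weighs at least \<open>a + k\<close>. Gluing minimisers of both sides gives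
  \<open>t \<le> w r + (?a1 + ?a2)\<close> with \<open>r\<close> and
  \<open>t \<le> ?b1 + ?b2\<close> without it, which is what a suitable choice of the shares
  requires.\<close>

lemma clique_sum_split:
  fixes w :: "'v \<Rightarrow> nat"
  assumes "finite V1" "finite V2" and r: "V1 \<inter> V2 = {r}"
    and E1: "\<And>e. e \<in> E1 \<Longrightarrow> e \<subseteq> V1 \<and> \<not> e \<subseteq> {r}"
    and E2: "\<And>e. e \<in> E2 \<Longrightarrow> e \<subseteq> V2 \<and> \<not> e \<subseteq> {r}"
    and cover: "\<And>C. vertex_cover (V1 \<union> V2) (E1 \<union> E2) C \<Longrightarrow> t \<le> sum w C"
  shows "\<exists>k1 k2 t1 t2. k1 + k2 \<le> w r \<and> t1 + t2 = t \<and>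
    (\<forall>C. vertex_cover V1 E1 C \<longrightarrow> t1 \<le> sum (w(r := k1)) C) \<and>
    (\<forall>C. vertex_cover V2 E2 C \<longrightarrow> t2 \<le> sum (w(r := k2)) C)"
proof -
  have minima: "\<exists>A B. vertex_cover U F A \<and> vertex_cover U F B \<and> r \<notin> B \<and>
      (\<forall>C. vertex_cover U F C \<longrightarrow> sum w (A - {r}) \<le> sum w (C - {r})) \<and>
      (\<forall>C. vertex_cover U F C \<and> r \<notin> C \<longrightarrow> sum w B \<le> sum w C)"
    if "\<forall>e \<in> F. e \<subseteq> U \<and> \<not> e \<subseteq> {r}" for U F
  proof -
    \<comment> \<open>No edge lies inside \<open>{r}\<close>, so every edge keeps an end when
      \<open>r\<close> is removed; hence covers avoiding \<open>r\<close> exist.\<close>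
    have c: "vertex_cover U F (U - {r})"
      using that unfolding vertex_cover_def by blast
    obtain A where "vertex_cover U F A" "\<forall>C. vertex_cover U F C \<longrightarrow> sum w (A - {r}) \<le> sum w (C - {r})"
      using ex_has_least_nat[of "vertex_cover U F" _ "\<lambda>C. sum w (C - {r})", OF c] by blast
    moreover obtain B where "vertex_cover U F B \<and> r \<notin> B"
      "\<forall>C. vertex_cover U F C \<and> r \<notin> C \<longrightarrow> sum w B \<le> sum w C"
      using ex_has_least_nat[of "\<lambda>C. vertex_cover U F C \<and> r \<notin> C" "U - {r}" "sum w"] c by blast
    ultimately show ?thesis by blast
  qed
  have e1: "\<forall>e \<in> E1. e \<subseteq> V1 \<and> \<not> e \<subseteq> {r}" and e2: "\<forall>e \<in> E2. e \<subseteq> V2 \<and> \<not> e \<subseteq> {r}"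
    using E1 E2 by simp_all
  obtain A1 B1 where 1: "vertex_cover V1 E1 A1" "vertex_cover V1 E1 B1" "r \<notin> B1"
    "\<forall>C. vertex_cover V1 E1 C \<longrightarrow> sum w (A1 - {r}) \<le> sum w (C - {r})"
    "\<forall>C. vertex_cover V1 E1 C \<and> r \<notin> C \<longrightarrow> sum w B1 \<le> sum w C"
    using minima[OF e1] by (elim exE conjE) (rule that)
  obtain A2 B2 where 2: "vertex_cover V2 E2 A2" "vertex_cover V2 E2 B2" "r \<notin> B2"
    "\<forall>C. vertex_cover V2 E2 C \<longrightarrow> sum w (A2 - {r}) \<le> sum w (C - {r})"
    "\<forall>C. vertex_cover V2 E2 C \<and> r \<notin> C \<longrightarrow> sum w B2 \<le> sum w C"
    using minima[OF e2] by (elim exE conjE) (rule that)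
  have sub: "A1 \<subseteq> V1" "B1 \<subseteq> V1" "A2 \<subseteq> V2" "B2 \<subseteq> V2"
    using 1 2 by (auto simp: vertex_cover_def)
  have fin: "finite A1" "finite A2" "finite B1" "finite B2"
    using sub assms(1,2) by (auto intro: finite_subset)
  let ?a1 = "sum w (A1 - {r})" and ?a2 = "sum w (A2 - {r})" and ?b1 = "sum w B1" and ?b2 = "sum w B2"
  have ab: "?a1 \<le> ?b1" "?a2 \<le> ?b2"
    using 1(4)[rule_format, OF 1(2)] 2(4)[rule_format, OF 2(2)] 1(3) 2(3) by simp_all
  have "vertex_cover (V1 \<union> V2) (E1 \<union> E2) (insert r (A1 \<union> A2))"
    using 1(1) 2(1) r unfolding vertex_cover_def by blast
  then have "t \<le> sum w (insert r (A1 \<union> A2))" by (rule cover)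
  also have "insert r (A1 \<union> A2) = insert r ((A1 - {r}) \<union> (A2 - {r}))" by auto
  also have "sum w \<dots> = w r + (?a1 + ?a2)"
    using fin sub r by (subst sum.insert, simp, simp, subst sum.union_disjoint) auto
  finally have a: "t \<le> w r + (?a1 + ?a2)" .
  have "vertex_cover (V1 \<union> V2) (E1 \<union> E2) (B1 \<union> B2)"
    using 1(2) 2(2) r unfolding vertex_cover_def by blast
  then have "t \<le> sum w (B1 \<union> B2)" by (rule cover)
  also have "\<dots> = ?b1 + ?b2"
    using fin sub r 1(3) by (intro sum.union_disjoint) auto
  finally have b: "t \<le> ?b1 + ?b2" .
  \<comment> \<open>Each side takes at most the share that its covers avoiding \<open>r\<close> can
    match. Either all of \<open>w r\<close> is used up, or the sides reach \<open>?b1\<close> and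
    \<open>?b2\<close>; the bounds \<open>a\<close> and \<open>b\<close> settle these two
    cases.\<close>
  define k1 where "k1 = min (w r) (?b1 - ?a1)"
  define k2 where "k2 = min (w r - k1) (?b2 - ?a2)"
  have bound: "a + k \<le> sum (w(r := k)) C"
    if "a \<le> sum w (C - {r})" "r \<notin> C \<Longrightarrow> a + k \<le> sum w C" "finite C" for a k C
  proof (cases "r \<in> C")
    case True
    have "sum (w(r := k)) C = k + sum w (C - {r})"
      using True \<open>finite C\<close> by (subst sum.remove[of C r]) (auto intro: sum.cong)
    with that show ?thesis by simp
  next
    case False
    then have "sum (w(r := k)) C = sum w C" by (intro sum.cong) auto
    with that False show ?thesis by simp
  qed
  have c1: "?a1 + k1 \<le> sum (w(r := k1)) C" if "vertex_cover V1 E1 C" for C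
  proof (rule bound)
    show "finite C" using that assms(1) by (auto simp: vertex_cover_def intro: finite_subset)
    show "?a1 + k1 \<le> sum w C" if "r \<notin> C"
      using 1(5)[rule_format, of C] \<open>vertex_cover V1 E1 C\<close> that ab by (simp add: k1_def)
  qed (use 1(4) that in blast)
  have c2: "?a2 + k2 \<le> sum (w(r := k2)) C" if "vertex_cover V2 E2 C" for C
  proof (rule bound)
    show "finite C" using that assms(2) by (auto simp: vertex_cover_def intro: finite_subset)
    show "?a2 + k2 \<le> sum w C" if "r \<notin> C"
      using 2(5)[rule_format, of C] \<open>vertex_cover V2 E2 C\<close> that ab by (simp add: k2_def)
  qed (use 2(4) that in blast)
  have "k1 + k2 \<le> w r" by (simp add: k1_def k2_def)
  have "t \<le> (?a1 + k1) + (?a2 + k2)"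
    using a b ab unfolding k1_def k2_def by linarith
  \<comment> \<open>The guaranteed weights may add up to more than \<open>t\<close>, so they are
    trimmed to sum to \<open>t\<close> exactly.\<close>
  moreover define t1 where "t1 = min t (?a1 + k1)"
  moreover define t2 where "t2 = t - t1"
  ultimately have t: "t1 + t2 = t" and t1: "t1 \<le> ?a1 + k1" and t2: "t2 \<le> ?a2 + k2"
    by linarith+
  with \<open>k1 + k2 \<le> w r\<close> show ?thesis
    using le_trans[OF t1 c1] le_trans[OF t2 c2]
    by (intro exI[of _ k1] exI[of _ k2] exI[of _ t1] exI[of _ t2] conjI allI impI)
qed

subsection \<open>Monomial ideals\<close>

lemma poly_ring_simps [simp]:
  "carrier (poly_ring V) = {p. \<forall>e \<in> Poly_Mapping.keys p. Poly_Mapping.keys e \<subseteq> V}"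
  "mult (poly_ring V) = (*)" "one (poly_ring V) = 1" "zero (poly_ring V) = 0" "add (poly_ring V) = (+)"
  by (simp_all add: poly_ring_def)

lemma keys_add_nat:
  "Poly_Mapping.keys (a + b) = Poly_Mapping.keys a \<union> Poly_Mapping.keys (b :: 'v \<Rightarrow>\<^sub>0 nat)"
  by (auto simp: in_keys_iff lookup_add)

lemma keys_sum_nat:
  "finite A \<Longrightarrow> Poly_Mapping.keys (sum f A) = (\<Union>a\<in>A. Poly_Mapping.keys (f a :: 'v \<Rightarrow>\<^sub>0 nat))"
  by (induction A rule: finite_induct) (auto simp: keys_add_nat)

lemma divides_iff_lookup_le:
  "(\<exists>d. e = s + d) \<longleftrightarrow> (\<forall>v. Poly_Mapping.lookup s v \<le> Poly_Mapping.lookup (e :: 'v \<Rightarrow>\<^sub>0 nat) v)"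
proof
  assume "\<forall>v. Poly_Mapping.lookup s v \<le> Poly_Mapping.lookup e v"
  then have "e = s + (e - s)"
    by (intro poly_mapping_eqI) (simp add: lookup_add lookup_minus)
  then show "\<exists>d. e = s + d" by blast
qed (auto simp: lookup_add)

lemma keys_mult_mem:
  assumes "e \<in> Poly_Mapping.keys (p * q)"
  obtains a b where "e = a + b" "a \<in> Poly_Mapping.keys p" "b \<in> Poly_Mapping.keys q"
  using assms keys_mult[of p q] by blast

lemma keys_uminus: "Poly_Mapping.keys (- p) = Poly_Mapping.keys (p :: 'a \<Rightarrow>\<^sub>0 'b::ab_group_add)"
  by (auto simp: in_keys_iff)

lemma cring_poly_ring: "cring (poly_ring V :: (('v \<Rightarrow>\<^sub>0 nat) \<Rightarrow>\<^sub>0 'k::field) ring)"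
proof (rule cringI)
  show "abelian_group (poly_ring V :: (('v \<Rightarrow>\<^sub>0 nat) \<Rightarrow>\<^sub>0 'k) ring)"
  proof (rule abelian_groupI)
    fix p q :: "('v \<Rightarrow>\<^sub>0 nat) \<Rightarrow>\<^sub>0 'k" assume "p \<in> carrier (poly_ring V)" "q \<in> carrier (poly_ring V)"
    then show "p \<oplus>\<^bsub>poly_ring V\<^esub> q \<in> carrier (poly_ring V)"
      using keys_add[of p q] by auto
  next
    fix p :: "('v \<Rightarrow>\<^sub>0 nat) \<Rightarrow>\<^sub>0 'k" assume "p \<in> carrier (poly_ring V)"
    then show "\<exists>q \<in> carrier (poly_ring V). q \<oplus>\<^bsub>poly_ring V\<^esub> p = \<zero>\<^bsub>poly_ring V\<^esub>"
      by (intro bexI[of _ "- p"]) (auto simp: keys_uminus)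
  qed (auto simp: ac_simps)
  show "comm_monoid (poly_ring V :: (('v \<Rightarrow>\<^sub>0 nat) \<Rightarrow>\<^sub>0 'k) ring)"
  proof (rule comm_monoidI)
    fix p q :: "('v \<Rightarrow>\<^sub>0 nat) \<Rightarrow>\<^sub>0 'k" assume "p \<in> carrier (poly_ring V)" "q \<in> carrier (poly_ring V)"
    then show "p \<otimes>\<^bsub>poly_ring V\<^esub> q \<in> carrier (poly_ring V)"
      by (auto simp: keys_add_nat elim!: keys_mult_mem; blast)
  qed (auto simp: ac_simps)
qed (auto simp: algebra_simps)

text \<open>Phrased through the support, so that membership is decided term by term and operations
  on ideals become operations on exponent sets. If \<open>S\<close> only involves variables from
  \<open>V\<close>, this is the ideal generated by its monomials, see
  \<open>mono_ideal_eq_Idl\<close>.\<close>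

definition mono_ideal :: "'v set \<Rightarrow> ('v \<Rightarrow>\<^sub>0 nat) set \<Rightarrow> (('v \<Rightarrow>\<^sub>0 nat) \<Rightarrow>\<^sub>0 'k::field) set"
  where "mono_ideal V S =
    {p. \<forall>e \<in> Poly_Mapping.keys p. Poly_Mapping.keys e \<subseteq> V \<and> (\<exists>s \<in> S. \<exists>d. e = s + d)}"

lemma single_mem_mono_ideal:
  assumes "s \<in> S" "Poly_Mapping.keys s \<subseteq> V" "Poly_Mapping.keys d \<subseteq> V"
  shows "Poly_Mapping.single (s + d) c \<in> mono_ideal V S"
  using assms unfolding mono_ideal_def by (auto simp: keys_add_nat)

lemma ideal_mono_ideal: "ideal (mono_ideal V S) (poly_ring V :: (('v \<Rightarrow>\<^sub>0 nat) \<Rightarrow>\<^sub>0 'k::field) ring)"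
proof -
  interpret cring "poly_ring V :: (('v \<Rightarrow>\<^sub>0 nat) \<Rightarrow>\<^sub>0 'k) ring" by (rule cring_poly_ring)
  have mult: "p * q \<in> mono_ideal V S"
    if pq: "p \<in> mono_ideal V S" "q \<in> carrier (poly_ring V)" for p q :: "('v \<Rightarrow>\<^sub>0 nat) \<Rightarrow>\<^sub>0 'k"
    unfolding mono_ideal_def
  proof (intro CollectI ballI)
    fix e assume "e \<in> Poly_Mapping.keys (p * q)"
    then obtain a b where e: "e = a + b" "a \<in> Poly_Mapping.keys p" "b \<in> Poly_Mapping.keys q"
      by (rule keys_mult_mem)
    then obtain s d where "s \<in> S" "a = s + d" "Poly_Mapping.keys a \<subseteq> V"
      using pq(1) unfolding mono_ideal_def by blast
    moreover have "Poly_Mapping.keys b \<subseteq> V" using pq(2) e by simp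
    ultimately show "Poly_Mapping.keys e \<subseteq> V \<and> (\<exists>s \<in> S. \<exists>d. e = s + d)"
      using e(1) by (metis Un_subset_iff add.assoc keys_add_nat)
  qed
  have uminus: "\<ominus>\<^bsub>poly_ring V\<^esub> p = - p"
    if "p \<in> carrier (poly_ring V)" for p :: "('v \<Rightarrow>\<^sub>0 nat) \<Rightarrow>\<^sub>0 'k"
    using that by (intro minus_equality) (auto simp: keys_uminus)
  show ?thesis
  proof (rule idealI)
    show "subgroup (mono_ideal V S) (add_monoid (poly_ring V :: (('v \<Rightarrow>\<^sub>0 nat) \<Rightarrow>\<^sub>0 'k) ring))"
    proof (rule add.subgroupI)
      show "mono_ideal V S \<subseteq> carrier (poly_ring V :: (('v \<Rightarrow>\<^sub>0 nat) \<Rightarrow>\<^sub>0 'k) ring)"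
        by (auto simp: mono_ideal_def)
      show "mono_ideal V S \<noteq> ({} :: (('v \<Rightarrow>\<^sub>0 nat) \<Rightarrow>\<^sub>0 'k) set)"
        by (auto simp: mono_ideal_def intro: exI[of _ 0])
    next
      fix p :: "('v \<Rightarrow>\<^sub>0 nat) \<Rightarrow>\<^sub>0 'k" assume p: "p \<in> mono_ideal V S"
      then have "\<ominus>\<^bsub>poly_ring V\<^esub> p = - p"
        by (intro uminus) (auto simp: mono_ideal_def)
      with p show "\<ominus>\<^bsub>poly_ring V\<^esub> p \<in> mono_ideal V S"
        by (simp add: mono_ideal_def keys_uminus)
    next
      fix p q :: "('v \<Rightarrow>\<^sub>0 nat) \<Rightarrow>\<^sub>0 'k" assume "p \<in> mono_ideal V S" "q \<in> mono_ideal V S"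
      then show "p \<oplus>\<^bsub>poly_ring V\<^esub> q \<in> mono_ideal V S"
        using keys_add[of p q] unfolding mono_ideal_def by auto
    qed
  next
    fix p q :: "('v \<Rightarrow>\<^sub>0 nat) \<Rightarrow>\<^sub>0 'k"
    assume "p \<in> mono_ideal V S" "q \<in> carrier (poly_ring V)"
    then show "q \<otimes>\<^bsub>poly_ring V\<^esub> p \<in> mono_ideal V S" "p \<otimes>\<^bsub>poly_ring V\<^esub> q \<in> mono_ideal V S"
      using mult[of p q] by (simp_all add: mult.commute)
  qed (rule ring_axioms)
qed

lemma sum_single_lookup: "p = (\<Sum>e \<in> Poly_Mapping.keys p. Poly_Mapping.single e (Poly_Mapping.lookup p e))"
proof (rule poly_mapping_eqI)
  fix k
  show "Poly_Mapping.lookup p k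
      = Poly_Mapping.lookup (\<Sum>e \<in> Poly_Mapping.keys p. Poly_Mapping.single e (Poly_Mapping.lookup p e)) k"
    by (cases "k \<in> Poly_Mapping.keys p")
      (auto simp: lookup_sum lookup_single when_def in_keys_iff)
qed

lemma mono_ideal_subsetI:
  fixes J :: "(('v \<Rightarrow>\<^sub>0 nat) \<Rightarrow>\<^sub>0 'k::field) set"
  assumes "ideal J (poly_ring V)"
    and "\<And>s d c. \<lbrakk>s \<in> S; Poly_Mapping.keys s \<subseteq> V; Poly_Mapping.keys d \<subseteq> V\<rbrakk>
      \<Longrightarrow> Poly_Mapping.single (s + d) c \<in> J"
  shows "mono_ideal V S \<subseteq> J"
proof
  fix p :: "('v \<Rightarrow>\<^sub>0 nat) \<Rightarrow>\<^sub>0 'k" assume p: "p \<in> mono_ideal V S"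
  have zero: "0 \<in> J" and add: "\<And>p q. p \<in> J \<Longrightarrow> q \<in> J \<Longrightarrow> p + q \<in> J"
    using additive_subgroup.zero_closed[OF ideal.axioms(1)[OF assms(1)]]
      additive_subgroup.a_closed[OF ideal.axioms(1)[OF assms(1)]] by simp_all
  have J_sum: "sum f A \<in> J" if "finite A" "\<And>a. a \<in> A \<Longrightarrow> f a \<in> J"
    for A and f :: "('v \<Rightarrow>\<^sub>0 nat) \<Rightarrow> ('v \<Rightarrow>\<^sub>0 nat) \<Rightarrow>\<^sub>0 'k"
    using that by (induction A rule: finite_induct) (use zero add in auto)
  have "(\<Sum>e \<in> Poly_Mapping.keys p. Poly_Mapping.single e (Poly_Mapping.lookup p e)) \<in> J"
  proof (rule J_sum)
    fix e assume "e \<in> Poly_Mapping.keys p"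
    then obtain s d where "s \<in> S" "e = s + d" "Poly_Mapping.keys e \<subseteq> V"
      using p unfolding mono_ideal_def by blast
    then show "Poly_Mapping.single e (Poly_Mapping.lookup p e) \<in> J"
      using assms(2)[of s d] by (simp add: keys_add_nat)
  qed simp
  then show "p \<in> J" by (simp only: sum_single_lookup[symmetric])
qed

lemma mono_ideal_eq_Idl:
  assumes "\<And>s. s \<in> S \<Longrightarrow> Poly_Mapping.keys s \<subseteq> V"
  shows "mono_ideal V S = Idl\<^bsub>poly_ring V\<^esub> ((monomial ` S) :: (('v \<Rightarrow>\<^sub>0 nat) \<Rightarrow>\<^sub>0 'k::field) set)"
proof
  let ?R = "poly_ring V :: (('v \<Rightarrow>\<^sub>0 nat) \<Rightarrow>\<^sub>0 'k) ring"
  interpret cring ?R by (rule cring_poly_ring)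
  have sub: "monomial ` S \<subseteq> carrier ?R"
    using assms by (auto simp: monomial_def subset_iff)
  interpret J: ideal "Idl\<^bsub>?R\<^esub> (monomial ` S)" ?R
    using sub by (rule genideal_ideal)
  show "mono_ideal V S \<subseteq> Idl\<^bsub>?R\<^esub> (monomial ` S)"
  proof (rule mono_ideal_subsetI[OF J.ideal_axioms])
    fix s d :: "'v \<Rightarrow>\<^sub>0 nat" and c :: 'k assume "s \<in> S" "Poly_Mapping.keys d \<subseteq> V"
    then have "monomial s \<otimes>\<^bsub>?R\<^esub> Poly_Mapping.single d c \<in> Idl\<^bsub>?R\<^esub> (monomial ` S)"
      using genideal_self[OF sub] by (intro J.I_r_closed) auto
    then show "Poly_Mapping.single (s + d) c \<in> Idl\<^bsub>?R\<^esub> (monomial ` S)"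
      by (simp add: monomial_def mult_single)
  qed
  show "Idl\<^bsub>?R\<^esub> (monomial ` S) \<subseteq> mono_ideal V S"
  proof (intro genideal_minimal ideal_mono_ideal subsetI)
    fix p :: "('v \<Rightarrow>\<^sub>0 nat) \<Rightarrow>\<^sub>0 'k" assume "p \<in> monomial ` S"
    then obtain s where "p = monomial s" "s \<in> S" by blast
    with assms[of s] show "p \<in> mono_ideal V S"
      using single_mem_mono_ideal[of s S V 0 1] by (simp add: monomial_def)
  qed
qed

lemma ideal_prod_mono_ideal:
  "ideal_prod (poly_ring V) (mono_ideal V S) (mono_ideal V T)
    = (mono_ideal V {s + t |s t. s \<in> S \<and> t \<in> T} :: (('v \<Rightarrow>\<^sub>0 nat) \<Rightarrow>\<^sub>0 'k::field) set)"
proof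
  let ?R = "poly_ring V :: (('v \<Rightarrow>\<^sub>0 nat) \<Rightarrow>\<^sub>0 'k) ring"
  interpret cring ?R by (rule cring_poly_ring)
  show "ideal_prod ?R (mono_ideal V S) (mono_ideal V T) \<subseteq> mono_ideal V {s + t |s t. s \<in> S \<and> t \<in> T}"
  proof
    fix p assume "p \<in> ideal_prod ?R (mono_ideal V S) (mono_ideal V T)"
    then show "p \<in> mono_ideal V {s + t |s t. s \<in> S \<and> t \<in> T}"
    proof induction
      case (prod p q)
      show ?case
        unfolding mono_ideal_def
      proof (intro CollectI ballI)
        fix e assume "e \<in> Poly_Mapping.keys (p \<otimes>\<^bsub>?R\<^esub> q)"
        then obtain a b where e: "e = a + b" "a \<in> Poly_Mapping.keys p" "b \<in> Poly_Mapping.keys q"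
          by (auto elim: keys_mult_mem)
        then obtain s d t d' where "s \<in> S" "a = s + d" "Poly_Mapping.keys a \<subseteq> V"
            "t \<in> T" "b = t + d'" "Poly_Mapping.keys b \<subseteq> V"
          using prod unfolding mono_ideal_def by blast
        moreover from this have "e = (s + t) + (d + d')" using e(1) by (simp add: ac_simps)
        ultimately show "Poly_Mapping.keys e \<subseteq> V \<and> (\<exists>s \<in> {s + t |s t. s \<in> S \<and> t \<in> T}. \<exists>d. e = s + d)"
          using e(1) by (auto simp: keys_add_nat)
      qed
    next
      case (sum p q)
      then show ?case
        using keys_add[of p q] unfolding mono_ideal_def by (simp, blast)
    qed
  qed
  show "mono_ideal V {s + t |s t. s \<in> S \<and> t \<in> T} \<subseteq> ideal_prod ?R (mono_ideal V S) (mono_ideal V T)"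
  proof (rule mono_ideal_subsetI)
    show "ideal (ideal_prod ?R (mono_ideal V S) (mono_ideal V T)) ?R"
      by (intro ideal_prod_is_ideal ideal_mono_ideal)
    fix r d :: "'v \<Rightarrow>\<^sub>0 nat" and c :: 'k
    assume "r \<in> {s + t |s t. s \<in> S \<and> t \<in> T}" "Poly_Mapping.keys r \<subseteq> V" "Poly_Mapping.keys d \<subseteq> V"
    then obtain s t where "r = s + t" "s \<in> S" "t \<in> T"
      "Poly_Mapping.keys s \<subseteq> V" "Poly_Mapping.keys (t + d) \<subseteq> V"
      by (auto simp: keys_add_nat)
    then have "Poly_Mapping.single s 1 \<otimes>\<^bsub>?R\<^esub> Poly_Mapping.single (t + d) c
        \<in> ideal_prod ?R (mono_ideal V S) (mono_ideal V T)"
      using single_mem_mono_ideal[of s S V 0 1] single_mem_mono_ideal[of t T V d c]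
      by (intro ideal_prod.prod) (simp_all add: keys_add_nat)
    then show "Poly_Mapping.single (r + d) c \<in> ideal_prod ?R (mono_ideal V S) (mono_ideal V T)"
      using \<open>r = s + t\<close> by (simp add: mult_single add.assoc)
  qed
qed

lemma set_add_mono_ideal:
  "mono_ideal V S <+>\<^bsub>poly_ring V\<^esub> mono_ideal V T
    = (mono_ideal V (S \<union> T) :: (('v \<Rightarrow>\<^sub>0 nat) \<Rightarrow>\<^sub>0 'k::field) set)"
proof
  let ?R = "poly_ring V :: (('v \<Rightarrow>\<^sub>0 nat) \<Rightarrow>\<^sub>0 'k) ring"
  interpret cring ?R by (rule cring_poly_ring)
  show "mono_ideal V S <+>\<^bsub>?R\<^esub> mono_ideal V T \<subseteq> mono_ideal V (S \<union> T)"
  proof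
    fix r assume "r \<in> mono_ideal V S <+>\<^bsub>?R\<^esub> mono_ideal V T"
    then obtain p q where "r = p + q" "p \<in> mono_ideal V S" "q \<in> mono_ideal V T"
      by (auto simp: set_add_def')
    then show "r \<in> mono_ideal V (S \<union> T)"
      using keys_add[of p q] unfolding mono_ideal_def by blast
  qed
  show "mono_ideal V (S \<union> T) \<subseteq> mono_ideal V S <+>\<^bsub>?R\<^esub> mono_ideal V T"
  proof (rule mono_ideal_subsetI)
    show "ideal (mono_ideal V S <+>\<^bsub>?R\<^esub> mono_ideal V T) ?R"
      by (intro add_ideals ideal_mono_ideal)
    fix s d :: "'v \<Rightarrow>\<^sub>0 nat" and c :: 'k
    assume "s \<in> S \<union> T" and k: "Poly_Mapping.keys s \<subseteq> V" "Poly_Mapping.keys d \<subseteq> V"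
    then consider "s \<in> S" | "s \<in> T" by blast
    then show "Poly_Mapping.single (s + d) c \<in> mono_ideal V S <+>\<^bsub>?R\<^esub> mono_ideal V T"
    proof cases
      case 1
      then have "Poly_Mapping.single (s + d) c \<in> mono_ideal V S" "0 \<in> (mono_ideal V T :: (('v \<Rightarrow>\<^sub>0 nat) \<Rightarrow>\<^sub>0 'k) set)"
        using k by (auto simp: mono_ideal_def keys_add_nat)
      then show ?thesis by (force simp: set_add_def')
    next
      case 2
      then have "Poly_Mapping.single (s + d) c \<in> mono_ideal V T" "0 \<in> (mono_ideal V S :: (('v \<Rightarrow>\<^sub>0 nat) \<Rightarrow>\<^sub>0 'k) set)"
        using k by (auto simp: mono_ideal_def keys_add_nat)
      then show ?thesis by (force simp: set_add_def')
    qed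
  qed
qed

lemma mono_ideal_subset:
  assumes "\<And>s. \<lbrakk>s \<in> S; Poly_Mapping.keys s \<subseteq> V\<rbrakk> \<Longrightarrow> \<exists>t \<in> T. \<exists>d. s = t + d"
  shows "mono_ideal V S \<subseteq> mono_ideal V T"
proof
  fix p :: "('a \<Rightarrow>\<^sub>0 nat) \<Rightarrow>\<^sub>0 'b" assume p: "p \<in> mono_ideal V S"
  show "p \<in> mono_ideal V T"
    unfolding mono_ideal_def
  proof (intro CollectI ballI)
    fix e assume "e \<in> Poly_Mapping.keys p"
    then obtain s d where s: "s \<in> S" "e = s + d" "Poly_Mapping.keys e \<subseteq> V"
      using p unfolding mono_ideal_def by blast
    then obtain t d' where "t \<in> T" "s = t + d'"
      using assms[of s] by (auto simp: keys_add_nat)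
    then have "t \<in> T" "e = t + (d' + d)" using s by (simp_all add: add.assoc)
    then show "Poly_Mapping.keys e \<subseteq> V \<and> (\<exists>s \<in> T. \<exists>d. e = s + d)"
      using s by blast
  qed
qed

lemma keys_edge_sums:
  assumes "\<Union>E \<subseteq> V" "s \<in> edge_sums E a"
  shows "Poly_Mapping.keys s \<subseteq> V"
  using assms(2)
proof (induction a arbitrary: s)
  case (Suc a)
  then obtain s' u v where "s = s' + (Poly_Mapping.single u 1 + Poly_Mapping.single v 1)"
    "s' \<in> edge_sums E a" "{u, v} \<in> E"
    by auto
  with Suc.IH[of s'] assms(1) show ?case by (auto simp: keys_add_nat)
qed simp

lemma edge_ideal_eq_mono_ideal:
  assumes "\<Union>E \<subseteq> V"
  shows "edge_ideal V E = (mono_ideal V (edge_sums E 1) :: (('v \<Rightarrow>\<^sub>0 nat) \<Rightarrow>\<^sub>0 'k::field) set)"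
proof -
  have "{pvar u * pvar v |u v. {u, v} \<in> E} = (monomial ` edge_sums E 1 :: (('v \<Rightarrow>\<^sub>0 nat) \<Rightarrow>\<^sub>0 'k) set)"
    by (auto simp: pvar_def monomial_def mult_single image_iff)
  then show ?thesis
    using keys_edge_sums[OF assms, of _ 1]
    by (simp only: edge_ideal_def mono_ideal_eq_Idl)
qed

lemma mult_ideals_set: "mult (ideals_set R) = ideal_prod R"
  by (simp add: ideals_set_def)

lemma ideal_power_edge_ideal:
  assumes "\<Union>E \<subseteq> V"
  shows "ideal_power (poly_ring V) (edge_ideal V E) t
    = (mono_ideal V (edge_sums E t) :: (('v \<Rightarrow>\<^sub>0 nat) \<Rightarrow>\<^sub>0 'k::field) set)"
proof (induction t)
  case 0
  \<comment> \<open>The zeroth power is the unit of the monoid of ideals, the whole ring, and so is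
    the ideal with the single generator exponent 0.\<close>
  show ?case by (auto simp: ideals_set_def mono_ideal_def)
next
  case (Suc t)
  interpret cring "poly_ring V :: (('v \<Rightarrow>\<^sub>0 nat) \<Rightarrow>\<^sub>0 'k) ring" by (rule cring_poly_ring)
  interpret M: comm_monoid "ideals_set (poly_ring V :: (('v \<Rightarrow>\<^sub>0 nat) \<Rightarrow>\<^sub>0 'k) ring)"
    by (rule ideals_set_is_comm_monoid)
  have "edge_sums E (Suc t) = {s + s' |s s'. s \<in> edge_sums E t \<and> s' \<in> edge_sums E 1}"
    by (auto; blast)
  then show ?case
    by (simp only: mult_ideals_set M.nat_pow_Suc Suc.IH[unfolded edge_ideal_eq_mono_ideal[OF assms]] ideal_prod_mono_ideal edge_ideal_eq_mono_ideal[OF assms])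
qed

text \<open>A monomial order is not available, as the variables carry no order. Instead \<open>(a, b)\<close> is chosen among
  the pairs of minimal weight so as to maximise the Euclidean norm of \<open>a + b\<close>: if \<open>a' + b' = a + b\<close>, then
  \<open>a + b'\<close> and \<open>a' + b\<close> are \<open>a + b\<close> plus and minus \<open>b' - b\<close>, and one of them is longer than \<open>a + b\<close>
  unless \<open>b' = b\<close>.\<close>

lemma unique_minimal_sum:
  fixes A B :: "('v \<Rightarrow>\<^sub>0 nat) set" and W :: "('v \<Rightarrow>\<^sub>0 nat) \<Rightarrow> nat"
  assumes W: "\<And>a b. W (a + b) = W a + W b"
    and "finite A" "A \<noteq> {}" "finite B" "B \<noteq> {}"
  obtains a b where "a \<in> A" "b \<in> B" "\<And>a'. a' \<in> A \<Longrightarrow> W a \<le> W a'" "\<And>b'. b' \<in> B \<Longrightarrow> W b \<le> W b'"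
    "\<And>a' b'. \<lbrakk>a' \<in> A; b' \<in> B; a' + b' = a + b\<rbrakk> \<Longrightarrow> a' = a \<and> b' = b"
proof -
  define least where "least X = {a \<in> X. \<forall>a' \<in> X. W a \<le> W a'}" for X
  have nonempty: "least X \<noteq> {}" if "X \<noteq> {}" for X
    using that ex_has_least_nat[of "\<lambda>a. a \<in> X" _ W] unfolding least_def by blast
  define T where "T = (\<Union>a \<in> A \<union> B. Poly_Mapping.keys a)"
  have "finite T" using assms by (simp add: T_def)
  define l where "l a v = int (Poly_Mapping.lookup a v)" for a :: "'v \<Rightarrow>\<^sub>0 nat" and v
  define N where "N a = (\<Sum>v \<in> T. (l a v)\<^sup>2)" for a
  have l_add: "l (a + b) v = l a v + l b v" for a b v by (simp add: l_def lookup_add)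
  let ?P = "least A \<times> least B" and ?N = "\<lambda>(a, b). N (a + b)"
  have "finite ?P" "?P \<noteq> {}"
    using assms nonempty by (auto simp: least_def)
  then have "Max (?N ` ?P) \<in> ?N ` ?P" by (intro Max_in) auto
  then obtain a b where ab: "a \<in> least A" "b \<in> least B" "Max (?N ` ?P) = N (a + b)" by auto
  have max: "N (a' + b') \<le> N (a + b)" if "a' \<in> least A" "b' \<in> least B" for a' b'
    using that \<open>finite ?P\<close> unfolding ab(3)[symmetric] by (intro Max_ge) auto
  show ?thesis
  proof (rule that)
    show "a \<in> A" "b \<in> B" using ab by (auto simp: least_def)
    show "W a \<le> W a'" if "a' \<in> A" for a' using ab that by (auto simp: least_def)
    show "W b \<le> W b'" if "b' \<in> B" for b' using ab that by (auto simp: least_def)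
    show "a' = a \<and> b' = b" if h: "a' \<in> A" "b' \<in> B" "a' + b' = a + b" for a' b'
    proof -
      \<comment> \<open>The least weights already add up to the weight of \<open>a + b\<close>, so
        the competing pair consists of elements of least weight too. Hence \<open>a + b'\<close> and
        \<open>a' + b\<close> take part in the maximum.\<close>
      have le: "W a \<le> W a'" "W b \<le> W b'" using ab h by (auto simp: least_def)
      have "W a' + W b' = W a + W b" using W[of a' b'] W[of a b] h(3) by simp
      with le have "W a' = W a" "W b' = W b" by linarith+
      then have mem: "a' \<in> least A" "b' \<in> least B"
        using ab h by (simp_all add: least_def)
      have "(l (a + b') v)\<^sup>2 + (l (a' + b) v)\<^sup>2 = 2 * (l (a + b) v)\<^sup>2 + 2 * (l b' v - l b v)\<^sup>2" for v
      proof -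
        have "l a' v = l a v + l b v - l b' v" using h(3) l_add[of a' b' v] l_add[of a b v] by simp
        moreover have "(p + q')\<^sup>2 + ((p + q - q') + q)\<^sup>2 = 2 * (p + q)\<^sup>2 + 2 * (q' - q)\<^sup>2" for p q q' :: int
          by (simp add: power2_eq_square algebra_simps)
        ultimately show ?thesis by (simp only: l_add)
      qed
      then have "N (a + b') + N (a' + b) = 2 * N (a + b) + 2 * (\<Sum>v \<in> T. (l b' v - l b v)\<^sup>2)"
        by (simp only: N_def sum_distrib_left sum.distrib[symmetric])
      then have "(\<Sum>v \<in> T. (l b' v - l b v)\<^sup>2) \<le> 0"
        using max[OF ab(1) mem(2)] max[OF mem(1) ab(2)] by linarith
      then have "(\<Sum>v \<in> T. (l b' v - l b v)\<^sup>2) = 0"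
        by (intro antisym sum_nonneg) simp_all
      then have eq: "l b' v = l b v" if "v \<in> T" for v
        using that \<open>finite T\<close> by (simp add: sum_nonneg_eq_0_iff)
      have "b' = b"
      proof (rule poly_mapping_eqI)
        fix v
        show "Poly_Mapping.lookup b' v = Poly_Mapping.lookup b v"
        proof (cases "v \<in> T")
          case True
          then show ?thesis using eq by (simp add: l_def)
        next
          case False
          then have "v \<notin> Poly_Mapping.keys b" "v \<notin> Poly_Mapping.keys b'"
            using h(2) ab(2) by (auto simp: T_def least_def)
          then show ?thesis by (simp add: in_keys_iff)
        qed
      qed
      with h(3) show ?thesis by simp
    qed
  qed
qed

text \<open>A single pair of terms contributes to the coefficient at \<open>a + b\<close>, and its
  contribution is a product of nonzero field elements, so nothing cancels.\<close>

lemma keys_mult_unique: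
  fixes p q :: "('v \<Rightarrow>\<^sub>0 nat) \<Rightarrow>\<^sub>0 'k::field"
  assumes "a \<in> Poly_Mapping.keys p" "b \<in> Poly_Mapping.keys q"
    and uniq: "\<And>a' b'. \<lbrakk>a' \<in> Poly_Mapping.keys p; b' \<in> Poly_Mapping.keys q; a' + b' = a + b\<rbrakk> \<Longrightarrow> a' = a \<and> b' = b"
  shows "a + b \<in> Poly_Mapping.keys (p * q)"
proof -
  let ?K = "Poly_Mapping.keys p" and ?L = "Poly_Mapping.keys q"
  let ?c = "\<lambda>a' b'. Poly_Mapping.lookup p a' * Poly_Mapping.lookup q b'"
  have "p * q = (\<Sum>a'\<in>?K. Poly_Mapping.single a' (Poly_Mapping.lookup p a'))
      * (\<Sum>b'\<in>?L. Poly_Mapping.single b' (Poly_Mapping.lookup q b'))"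
    by (simp only: sum_single_lookup[symmetric])
  also have "\<dots> = (\<Sum>a'\<in>?K. \<Sum>b'\<in>?L. Poly_Mapping.single (a' + b') (?c a' b'))"
    by (simp only: sum_product mult_single)
  finally have "Poly_Mapping.lookup (p * q) (a + b)
      = (\<Sum>a'\<in>?K. \<Sum>b'\<in>?L. ?c a' b' when a' + b' = a + b)"
    by (simp only: lookup_sum lookup_single)
  also have "\<dots> = (\<Sum>a'\<in>?K. \<Sum>b'\<in>?L. if a' = a then if b' = b then ?c a' b' else 0 else 0)"
    using uniq by (intro sum.cong) (auto simp: when_def)
  also have "\<dots> = (\<Sum>a'\<in>?K. if a' = a then \<Sum>b'\<in>?L. if b' = b then ?c a' b' else 0 else 0)"
    by (intro sum.cong) auto
  also have "\<dots> = ?c a b"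
    using assms(1,2) by simp
  finally show ?thesis
    using assms(1,2) by (simp add: in_keys_iff)
qed

lemma keys_monomial_mult:
  fixes p :: "('v \<Rightarrow>\<^sub>0 nat) \<Rightarrow>\<^sub>0 'k::field"
  shows "Poly_Mapping.keys (monomial s * p) = (+) s ` Poly_Mapping.keys p"
proof
  show "Poly_Mapping.keys (monomial s * p) \<subseteq> (+) s ` Poly_Mapping.keys p"
    by (auto simp: monomial_def elim!: keys_mult_mem)
  have "s + b \<in> Poly_Mapping.keys (monomial s * p)" if "b \<in> Poly_Mapping.keys p" for b
    using that by (intro keys_mult_unique) (auto simp: monomial_def)
  then show "(+) s ` Poly_Mapping.keys p \<subseteq> Poly_Mapping.keys (monomial s * p)"
    by blast
qed

text \<open>This makes the least \<open>W\<close> among the terms of a polynomial behave like a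
  valuation: some term of the product attains the sum of the two minima.\<close>

lemma minimal_key_mult:
  fixes p q :: "('v \<Rightarrow>\<^sub>0 nat) \<Rightarrow>\<^sub>0 'k::field"
  assumes "\<And>a b. W (a + b) = W a + W b" and "p \<noteq> 0" "q \<noteq> 0"
  obtains a b where "a \<in> Poly_Mapping.keys p" "b \<in> Poly_Mapping.keys q" "a + b \<in> Poly_Mapping.keys (p * q)"
    "\<And>a'. a' \<in> Poly_Mapping.keys p \<Longrightarrow> W a \<le> (W a' :: nat)" "\<And>b'. b' \<in> Poly_Mapping.keys q \<Longrightarrow> W b \<le> W b'"
proof -
  have ne: "Poly_Mapping.keys r \<noteq> {}" if "r \<noteq> 0" for r :: "('v \<Rightarrow>\<^sub>0 nat) \<Rightarrow>\<^sub>0 'k"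
    using that by (metis poly_mapping_eqI lookup_zero not_in_keys_iff_lookup_eq_zero empty_iff)
  obtain a b where "a \<in> Poly_Mapping.keys p" "b \<in> Poly_Mapping.keys q"
    "\<And>a'. a' \<in> Poly_Mapping.keys p \<Longrightarrow> W a \<le> W a'" "\<And>b'. b' \<in> Poly_Mapping.keys q \<Longrightarrow> W b \<le> W b'"
    "\<And>a' b'. \<lbrakk>a' \<in> Poly_Mapping.keys p; b' \<in> Poly_Mapping.keys q; a' + b' = a + b\<rbrakk> \<Longrightarrow> a' = a \<and> b' = b"
    by (rule unique_minimal_sum[of W "Poly_Mapping.keys p" "Poly_Mapping.keys q", OF assms(1) _ ne _ ne])
      (use assms(2,3) in auto)
  then show ?thesis
    using keys_mult_unique[of a p b q] by (intro that[of a b]) auto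
qed

section \<open>The prime of a cover and its powers\<close>

lemma vertex_weight_add: "vertex_weight C (a + b) = vertex_weight C a + vertex_weight C b"
  by (simp add: vertex_weight_def lookup_add sum.distrib)

lemma vertex_weight_pos_iff:
  "finite C \<Longrightarrow> 1 \<le> vertex_weight C e \<longleftrightarrow> Poly_Mapping.keys e \<inter> C \<noteq> {}"
  by (auto simp: vertex_weight_def in_keys_iff Suc_le_eq sum_nonneg_eq_0_iff simp flip: neq0_conv)

text \<open>For finite \<open>C \<subseteq> V\<close> this ideal is the \<open>t\<close>-th power of
  the prime generated by the variables in \<open>C\<close>. Weights are additive, so its exponent
  set is closed under multiples and membership can be read off from the weight of each term.\<close>

lemma mem_weight_ideal_iff:
  "p \<in> mono_ideal V {e. t \<le> vertex_weight C e}
    \<longleftrightarrow> (\<forall>e \<in> Poly_Mapping.keys p. Poly_Mapping.keys e \<subseteq> V \<and> t \<le> vertex_weight C e)"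
proof -
  have "(\<exists>s \<in> {e. t \<le> vertex_weight C e}. \<exists>d. e = s + d) \<longleftrightarrow> t \<le> vertex_weight C e" for e
  proof
    assume "t \<le> vertex_weight C e"
    then show "\<exists>s \<in> {e. t \<le> vertex_weight C e}. \<exists>d. e = s + d"
      by (intro bexI[of _ e] exI[of _ 0]) auto
  qed (auto simp: vertex_weight_add)
  then show ?thesis by (simp add: mono_ideal_def)
qed

text \<open>Some term of a product has as its weight the sum of the least weights of the factors. If
  this is positive, all terms of one factor have positive weight.\<close>

lemma primeideal_weight_ideal:
  "primeideal (mono_ideal V {e. 1 \<le> vertex_weight C e}) (poly_ring V :: (('v \<Rightarrow>\<^sub>0 nat) \<Rightarrow>\<^sub>0 'k::field) ring)"
proof (rule primeidealI[OF ideal_mono_ideal cring_poly_ring])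
  have "1 \<notin> (mono_ideal V {e. 1 \<le> vertex_weight C e} :: (('v \<Rightarrow>\<^sub>0 nat) \<Rightarrow>\<^sub>0 'k) set)"
    unfolding mem_weight_ideal_iff by (simp add: vertex_weight_def)
  moreover have "(1 :: ('v \<Rightarrow>\<^sub>0 nat) \<Rightarrow>\<^sub>0 'k) \<in> carrier (poly_ring V)" by simp
  ultimately show "carrier (poly_ring V) \<noteq> (mono_ideal V {e. 1 \<le> vertex_weight C e} :: (('v \<Rightarrow>\<^sub>0 nat) \<Rightarrow>\<^sub>0 'k) set)"
    by blast
next
  fix p q :: "('v \<Rightarrow>\<^sub>0 nat) \<Rightarrow>\<^sub>0 'k"
  assume car: "p \<in> carrier (poly_ring V)" "q \<in> carrier (poly_ring V)"
    and pq: "p \<otimes>\<^bsub>poly_ring V\<^esub> q \<in> mono_ideal V {e. 1 \<le> vertex_weight C e}"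
  show "p \<in> mono_ideal V {e. 1 \<le> vertex_weight C e} \<or> q \<in> mono_ideal V {e. 1 \<le> vertex_weight C e}"
  proof (cases "p = 0 \<or> q = 0")
    case True
    then show ?thesis by (auto simp: mem_weight_ideal_iff)
  next
    case False
    then obtain a b where ab: "a + b \<in> Poly_Mapping.keys (p * q)"
      "\<And>a'. a' \<in> Poly_Mapping.keys p \<Longrightarrow> vertex_weight C a \<le> vertex_weight C a'"
      "\<And>b'. b' \<in> Poly_Mapping.keys q \<Longrightarrow> vertex_weight C b \<le> vertex_weight C b'"
      using minimal_key_mult[of "vertex_weight C" p q, OF vertex_weight_add] by metis
    then have "1 \<le> vertex_weight C a + vertex_weight C b"
      using pq by (auto simp: mem_weight_ideal_iff vertex_weight_add[symmetric])
    then have "1 \<le> vertex_weight C a \<or> 1 \<le> vertex_weight C b" by linarith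
    then show ?thesis
      using ab(2,3) car by (fastforce simp: mem_weight_ideal_iff)
  qed
qed

text \<open>Outside the prime, \<open>s\<close> has a term of weight 0, so passing from
  \<open>h\<close> to \<open>s * h\<close> does not raise the least weight. Hence contracting from
  the localization adds nothing to this power.\<close>

lemma weight_ideal_primary:
  fixes h s :: "('v \<Rightarrow>\<^sub>0 nat) \<Rightarrow>\<^sub>0 'k::field"
  assumes "h \<in> carrier (poly_ring V)"
    and "s \<in> carrier (poly_ring V) - mono_ideal V {e. 1 \<le> vertex_weight C e}"
    and "s * h \<in> mono_ideal V {e. t \<le> vertex_weight C e}"
  shows "h \<in> mono_ideal V {e. t \<le> vertex_weight C e}"
proof (cases "h = 0")
  case True
  then show ?thesis by (simp add: mem_weight_ideal_iff)
next
  case False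
  obtain k where k: "k \<in> Poly_Mapping.keys s" "vertex_weight C k = 0"
    using assms(2) by (auto simp: mem_weight_ideal_iff not_less_eq_eq)
  then have "s \<noteq> 0" by auto
  then obtain a b where ab: "a + b \<in> Poly_Mapping.keys (s * h)"
    "\<And>a'. a' \<in> Poly_Mapping.keys s \<Longrightarrow> vertex_weight C a \<le> vertex_weight C a'"
    "\<And>b'. b' \<in> Poly_Mapping.keys h \<Longrightarrow> vertex_weight C b \<le> vertex_weight C b'"
    using minimal_key_mult[of "vertex_weight C" s h, OF vertex_weight_add] False by metis
  then have "t \<le> vertex_weight C a + vertex_weight C b"
    using assms(3) by (auto simp: mem_weight_ideal_iff vertex_weight_add[symmetric])
  moreover have "vertex_weight C a = 0" using ab(2)[OF k(1)] k(2) by simp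
  ultimately have "t \<le> vertex_weight C b" by simp
  then show ?thesis
    using ab(3) assms(1) by (fastforce simp: mem_weight_ideal_iff)
qed

lemma mem_ass_primes_iff:
  assumes "cring R" "ideal I R"
  shows "p \<in> ass_primes R I \<longleftrightarrow> primeideal p R \<and> (\<exists>f \<in> carrier R. p = {r \<in> carrier R. r \<otimes>\<^bsub>R\<^esub> f \<in> I})"
proof -
  interpret cring R by fact
  interpret I: ideal I R by fact
  have "I +>\<^bsub>R\<^esub> x = \<zero>\<^bsub>R Quot I\<^esub> \<longleftrightarrow> x \<in> I" if "x \<in> carrier R" for x
    using that I.rcos_const_imp_mem a_rcos_zero[OF assms(2)] by (auto simp: FactRing_def)
  then show ?thesis
    unfolding ass_primes_def by (auto cong: conj_cong)
qed

subsection \<open>Symbolic powers of edge ideals\<close>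

text \<open>Used to select exactly \<open>t\<close> factors of a monomial inside a cover.\<close>

lemma exists_smaller_sum:
  fixes f :: "'a \<Rightarrow> nat"
  assumes "finite C" "t \<le> sum f C"
  shows "\<exists>g. (\<forall>v. g v \<le> f v) \<and> sum g C = t"
  using assms
proof (induction C arbitrary: t rule: finite_induct)
  case empty
  then show ?case by auto
next
  case (insert x C)
  then have "t - min t (f x) \<le> sum f C" by simp
  then obtain g where g: "\<forall>v. g v \<le> f v" "sum g C = t - min t (f x)"
    using insert.IH by blast
  have "sum (g(x := min t (f x))) (insert x C) = min t (f x) + sum g C"
    using insert(1,2) by (subst sum.insert) (auto intro: sum.cong)
  with g show ?case by (intro exI[of _ "g(x := min t (f x))"]) auto
qed

lemma vertex_cover_edge: "vertex_cover V E C \<Longrightarrow> e \<in> E \<Longrightarrow> e \<inter> C \<noteq> {}"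
  by (simp add: vertex_cover_def)

lemma mono_idealI:
  assumes "\<And>e. e \<in> Poly_Mapping.keys p \<Longrightarrow> Poly_Mapping.keys e \<subseteq> V" "\<And>e. e \<in> Poly_Mapping.keys p \<Longrightarrow> e \<in> S"
  shows "p \<in> mono_ideal V S"
  unfolding mono_ideal_def
proof (intro CollectI ballI conjI)
  fix e assume "e \<in> Poly_Mapping.keys p"
  then show "Poly_Mapping.keys e \<subseteq> V" "\<exists>s \<in> S. \<exists>d. e = s + d"
    using assms by (auto intro: bexI[of _ e] exI[of _ 0])
qed

locale finite_simple_graph =
  fixes V :: "'v set" and E :: "'v set set"
  assumes finite_V: "finite V"
    and edges: "e \<in> E \<Longrightarrow> \<exists>u v. e = {u, v} \<and> u \<noteq> v \<and> u \<in> V \<and> v \<in> V"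
begin

lemma edge_subset: "\<Union>E \<subseteq> V"
  using edges by blast

lemma edge_ends: "{u, v} \<in> E \<Longrightarrow> u \<noteq> v \<and> u \<in> V \<and> v \<in> V"
  using edges[of "{u, v}"] by (auto simp: doubleton_eq_iff)

text \<open>The ends of an edge differ, so its monomial is squarefree and divisibility by it depends
  on the support alone.\<close>

lemma edge_divides_iff:
  "(\<exists>s \<in> edge_sums E 1. \<exists>d. e = s + d)
    \<longleftrightarrow> (\<exists>u v. {u, v} \<in> E \<and> u \<in> Poly_Mapping.keys e \<and> v \<in> Poly_Mapping.keys e)"
proof -
  have "(\<exists>d. e = (Poly_Mapping.single u 1 + Poly_Mapping.single v 1) + d)
      \<longleftrightarrow> u \<in> Poly_Mapping.keys e \<and> v \<in> Poly_Mapping.keys e" if "{u, v} \<in> E" for u v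
  proof -
    have "Poly_Mapping.lookup (Poly_Mapping.single u 1 + Poly_Mapping.single v (1::nat)) x = (if x = u \<or> x = v then 1 else 0)" for x
      using edge_ends[OF that] by (auto simp: lookup_add lookup_single when_def)
    then have "(\<exists>d. e = (Poly_Mapping.single u 1 + Poly_Mapping.single v 1) + d)
        \<longleftrightarrow> (\<forall>x. (if x = u \<or> x = v then 1 else 0) \<le> Poly_Mapping.lookup e x)"
      by (simp only: divides_iff_lookup_le)
    also have "\<dots> \<longleftrightarrow> 1 \<le> Poly_Mapping.lookup e u \<and> 1 \<le> Poly_Mapping.lookup e v"
      by (metis zero_le)
    finally show ?thesis
      by (simp add: in_keys_iff Suc_le_eq)
  qed
  then show ?thesis by (auto; metis)
qed

lemma vertex_cover_contains_minimal:
  assumes "vertex_cover V E C"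
  obtains C' where "C' \<subseteq> C" "minimal_vertex_cover V E C'"
proof -
  have "finite C" if "vertex_cover V E C" for C
    using that finite_V by (auto simp: vertex_cover_def intro: finite_subset)
  then show ?thesis
    using assms that
  proof (induction "card C" arbitrary: C rule: less_induct)
    case less
    show ?case
    proof (cases "minimal_vertex_cover V E C")
      case False
      then obtain C' where C': "C' \<subset> C" "vertex_cover V E C'"
        using less.prems by (auto simp: minimal_vertex_cover_def)
      then have "card C' < card C" using less.prems by (intro psubset_card_mono) auto
      then show ?thesis using less.hyps[of C'] C' less.prems by blast
    qed (use less.prems in blast)
  qed
qed

text \<open>The prime annihilates, modulo the edge ideal, the product of the vertices outside the cover.\<close>

lemma ass_prime_of_minimal_cover:
  assumes "minimal_vertex_cover V E C"
  shows "mono_ideal V {e. 1 \<le> vertex_weight C e}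
    \<in> ass_primes (poly_ring V :: (('v \<Rightarrow>\<^sub>0 nat) \<Rightarrow>\<^sub>0 'k::field) ring) (edge_ideal V E)"
proof -
  let ?R = "poly_ring V :: (('v \<Rightarrow>\<^sub>0 nat) \<Rightarrow>\<^sub>0 'k) ring"
  have cover: "vertex_cover V E C" and minimal: "\<And>C'. C' \<subset> C \<Longrightarrow> \<not> vertex_cover V E C'"
    using assms by (auto simp: minimal_vertex_cover_def)
  have "C \<subseteq> V" using cover by (simp add: vertex_cover_def)
  then have "finite C" using finite_V finite_subset by blast
  define z :: "'v \<Rightarrow>\<^sub>0 nat" where "z = (\<Sum>v \<in> V - C. Poly_Mapping.single v 1)"
  have keys_z: "Poly_Mapping.keys z = V - C"
    unfolding z_def using finite_V by (subst keys_sum_nat) auto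
  have key: "1 \<le> vertex_weight C e \<longleftrightarrow> (\<exists>s \<in> edge_sums E 1. \<exists>d. z + e = s + d)"
    if "Poly_Mapping.keys e \<subseteq> V" for e
    unfolding edge_divides_iff vertex_weight_pos_iff[OF \<open>finite C\<close>] keys_add_nat keys_z
  proof
    assume "Poly_Mapping.keys e \<inter> C \<noteq> {}"
    then obtain v where v: "v \<in> Poly_Mapping.keys e" "v \<in> C" by blast
    \<comment> \<open>Minimality gives an edge that meets \<open>C\<close> in \<open>v\<close>
      alone. Both ends lie in the support of \<open>z + e\<close>: \<open>v\<close> through
      \<open>e\<close>, the other one through \<open>z\<close>.\<close>
    then have "\<not> vertex_cover V E (C - {v})" by (intro minimal) auto
    then obtain f where f: "f \<in> E" "f \<inter> (C - {v}) = {}"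
      using \<open>C \<subseteq> V\<close> by (auto simp: vertex_cover_def)
    obtain a b where ab: "f = {a, b}" "a \<in> V" "b \<in> V" using edges f(1) by blast
    have "f \<inter> C \<noteq> {}" using vertex_cover_edge[OF cover f(1)] .
    with f(2) have "v \<in> f" by blast
    then show "\<exists>u w. {u, w} \<in> E \<and> u \<in> (V - C) \<union> Poly_Mapping.keys e \<and> w \<in> (V - C) \<union> Poly_Mapping.keys e"
      using f v ab by (intro exI[of _ a] exI[of _ b]) auto
  next
    assume "\<exists>u w. {u, w} \<in> E \<and> u \<in> (V - C) \<union> Poly_Mapping.keys e \<and> w \<in> (V - C) \<union> Poly_Mapping.keys e"
    then obtain u w where uw: "{u, w} \<in> E" "u \<in> (V - C) \<union> Poly_Mapping.keys e" "w \<in> (V - C) \<union> Poly_Mapping.keys e"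
      by blast
    have "{u, w} \<inter> C \<noteq> {}" using vertex_cover_edge[OF cover uw(1)] .
    then show "Poly_Mapping.keys e \<inter> C \<noteq> {}" using uw(2,3) by blast
  qed
  have eq: "mono_ideal V {e. 1 \<le> vertex_weight C e}
      = {r \<in> carrier ?R. r \<otimes>\<^bsub>?R\<^esub> monomial z \<in> edge_ideal V E}"
  proof (rule Set.set_eqI)
    fix r :: "('v \<Rightarrow>\<^sub>0 nat) \<Rightarrow>\<^sub>0 'k"
    have "Poly_Mapping.keys (r * monomial z) = (+) z ` Poly_Mapping.keys r"
      using keys_monomial_mult[of z r] by (simp only: mult.commute)
    then have "r * monomial z \<in> edge_ideal V E \<longleftrightarrow>
        (\<forall>e \<in> Poly_Mapping.keys r. Poly_Mapping.keys e \<subseteq> V \<and> (\<exists>s \<in> edge_sums E 1. \<exists>d. z + e = s + d))"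
      unfolding edge_ideal_eq_mono_ideal[OF edge_subset] mono_ideal_def
      by (simp add: keys_add_nat keys_z)
    then show "r \<in> mono_ideal V {e. 1 \<le> vertex_weight C e}
        \<longleftrightarrow> r \<in> {r \<in> carrier ?R. r \<otimes>\<^bsub>?R\<^esub> monomial z \<in> edge_ideal V E}"
      unfolding mem_weight_ideal_iff using key by auto
  qed
  have "monomial z \<in> carrier ?R"
    by (simp add: monomial_def keys_z)
  moreover have "ideal (edge_ideal V E) ?R"
    unfolding edge_ideal_eq_mono_ideal[OF edge_subset] by (rule ideal_mono_ideal)
  ultimately show ?thesis
    using eq primeideal_weight_ideal[of V C] mem_ass_primes_iff[OF cring_poly_ring] by blast
qed

lemma edge_sums_weight:
  assumes "vertex_cover V E C" "s \<in> edge_sums E t"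
  shows "t \<le> vertex_weight C s"
  using assms(2)
proof (induction t arbitrary: s)
  case (Suc t)
  then obtain s' u v where s: "s = s' + (Poly_Mapping.single u 1 + Poly_Mapping.single v 1)"
    "s' \<in> edge_sums E t" "{u, v} \<in> E"
    by auto
  have "finite C" using assms(1) finite_V by (auto simp: vertex_cover_def intro: finite_subset)
  moreover have "{u, v} \<inter> C \<noteq> {}" using vertex_cover_edge[OF assms(1) s(3)] .
  ultimately have "1 \<le> vertex_weight C (Poly_Mapping.single u 1 + Poly_Mapping.single v 1)"
    by (simp only: vertex_weight_pos_iff keys_add_nat) auto
  then show ?case using Suc.IH[OF s(2)] s(1) by (simp add: vertex_weight_add)
qed simp

text \<open>Let \<open>p\<close> be the annihilator of \<open>f\<close> modulo the edge ideal; some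
  term \<open>e\<close> of \<open>f\<close> then has independent support. A variable in
  \<open>p\<close> multiplies this term into the ideal and so has a neighbour in the support,
  whereas the support itself contains no variable of \<open>p\<close>. The neighbours
  \<open>nb v\<close> become units after localization at \<open>p\<close>.\<close>

lemma ass_prime_cover:
  fixes p :: "(('v \<Rightarrow>\<^sub>0 nat) \<Rightarrow>\<^sub>0 'k::field) set"
  assumes "p \<in> ass_primes (poly_ring V) (edge_ideal V E)"
  obtains C nb where "minimal_vertex_cover V E C"
    "\<And>v. v \<in> C \<Longrightarrow> {v, nb v} \<in> E \<and> pvar (nb v) \<notin> p"
proof -
  let ?R = "poly_ring V :: (('v \<Rightarrow>\<^sub>0 nat) \<Rightarrow>\<^sub>0 'k) ring" and ?I = "edge_ideal V E :: (('v \<Rightarrow>\<^sub>0 nat) \<Rightarrow>\<^sub>0 'k) set"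
  have I: "ideal ?I ?R"
    unfolding edge_ideal_eq_mono_ideal[OF edge_subset] by (rule ideal_mono_ideal)
  interpret I: ideal ?I ?R by fact
  obtain f where p: "primeideal p ?R" and f: "f \<in> carrier ?R" and pf: "p = {r \<in> carrier ?R. r * f \<in> ?I}"
    using assms by (auto simp: mem_ass_primes_iff[OF cring_poly_ring I])
  interpret p: primeideal p ?R by fact
  have "1 \<notin> p" using p.one_imp_carrier p.I_notcarr by auto
  then have "f \<notin> ?I" using pf by auto
  then obtain e where e: "e \<in> Poly_Mapping.keys f"
    and indep: "\<And>u v. {u, v} \<in> E \<Longrightarrow> u \<in> Poly_Mapping.keys e \<Longrightarrow> v \<notin> Poly_Mapping.keys e"
    using f unfolding edge_ideal_eq_mono_ideal[OF edge_subset] mono_ideal_def edge_divides_iff by auto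
  define C where "C = {v \<in> V. (pvar v :: ('v \<Rightarrow>\<^sub>0 nat) \<Rightarrow>\<^sub>0 'k) \<in> p}"
  have pvar_carrier: "(pvar v :: ('v \<Rightarrow>\<^sub>0 nat) \<Rightarrow>\<^sub>0 'k) \<in> carrier ?R" if "v \<in> V" for v
    using that by (simp add: pvar_def monomial_def)
  have nb: "\<exists>u. {v, u} \<in> E \<and> u \<in> Poly_Mapping.keys e" if "v \<in> C" for v
  proof -
    have "pvar v * f \<in> ?I" using that pf by (auto simp: C_def)
    \<comment> \<open>Multiplication by a variable shifts the terms without cancellation, and a
      monomial ideal contains every term of its members. As the support of \<open>e\<close> is
      independent, the edge obtained must use \<open>v\<close>.\<close>
    moreover have "Poly_Mapping.single v 1 + e \<in> Poly_Mapping.keys (pvar v * f)"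
      using e by (simp add: pvar_def keys_monomial_mult)
    ultimately obtain a b where "{a, b} \<in> E" "a \<in> insert v (Poly_Mapping.keys e)" "b \<in> insert v (Poly_Mapping.keys e)"
      unfolding edge_ideal_eq_mono_ideal[OF edge_subset] mono_ideal_def edge_divides_iff
      by (auto simp: keys_add_nat)
    then show ?thesis
      using indep[of a b] edge_ends[of a b] by (auto simp: insert_commute)
  qed
  have nb_notin: "pvar u \<notin> p" if "u \<in> Poly_Mapping.keys e" for u
  proof
    assume "pvar u \<in> p"
    moreover have "u \<in> V" using that e f by auto
    ultimately obtain w where "{u, w} \<in> E" "w \<in> Poly_Mapping.keys e" using nb[of u] by (auto simp: C_def)
    with indep that show False by blast
  qed
  have cover: "vertex_cover V E C"
    unfolding vertex_cover_def
  proof (intro conjI ballI)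
    fix e assume "e \<in> E"
    then obtain u v where uv: "e = {u, v}" "u \<in> V" "v \<in> V" using edges by blast
    have "Poly_Mapping.single u 1 + Poly_Mapping.single v 1 \<in> edge_sums E 1" using \<open>e \<in> E\<close> uv by auto
    then have "pvar u \<otimes>\<^bsub>?R\<^esub> pvar v \<in> ?I"
      unfolding edge_ideal_eq_mono_ideal[OF edge_subset]
      using uv single_mem_mono_ideal[of "Poly_Mapping.single u 1 + Poly_Mapping.single v 1" "edge_sums E 1" V 0 1]
      by (simp add: pvar_def monomial_def mult_single keys_add_nat)
    then have "(pvar u \<otimes>\<^bsub>?R\<^esub> pvar v) \<otimes>\<^bsub>?R\<^esub> f \<in> ?I" using f by (rule I.I_r_closed)
    moreover have "pvar u \<otimes>\<^bsub>?R\<^esub> pvar v \<in> carrier ?R"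
      by (intro I.m_closed pvar_carrier uv)
    ultimately have "pvar u \<otimes>\<^bsub>?R\<^esub> pvar v \<in> p" unfolding pf by simp
    then have "pvar u \<in> p \<or> pvar v \<in> p" by (intro p.I_prime pvar_carrier uv)
    then show "e \<inter> C \<noteq> {}" using uv by (auto simp: C_def)
  qed (auto simp: C_def)
  obtain nb where nb: "\<And>v. v \<in> C \<Longrightarrow> {v, nb v} \<in> E \<and> nb v \<in> Poly_Mapping.keys e"
    using nb by metis
  have "\<not> vertex_cover V E C'" if sub: "C' \<subset> C" for C'
  proof
    assume C': "vertex_cover V E C'"
    obtain v where v: "v \<in> C" "v \<notin> C'" using sub by blast
    \<comment> \<open>Without \<open>v\<close>, the edge to \<open>nb v\<close> can only be covered
      at \<open>nb v\<close>, whose variable is outside \<open>p\<close>.\<close>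
    then have "nb v \<in> C'" using C' nb[OF v(1)] by (auto simp: vertex_cover_def)
    then show False using sub nb_notin nb[OF v(1)] by (auto simp: C_def)
  qed
  with cover have "minimal_vertex_cover V E C" by (simp add: minimal_vertex_cover_def)
  then show ?thesis using nb nb_notin by (intro that[of C nb]) auto
qed

text \<open>The primes of minimal covers suffice for the upper bound. The lower bound has to treat
  an arbitrary associated prime \<open>p\<close>, by exhibiting one multiplier outside
  \<open>p\<close>.\<close>

lemma symbolic_power_edge_ideal:
  "symbolic_power (poly_ring V) (edge_ideal V E) t
    = (mono_ideal V {e. \<forall>C. minimal_vertex_cover V E C \<longrightarrow> t \<le> vertex_weight C e}
        :: (('v \<Rightarrow>\<^sub>0 nat) \<Rightarrow>\<^sub>0 'k::field) set)"
proof
  let ?R = "poly_ring V :: (('v \<Rightarrow>\<^sub>0 nat) \<Rightarrow>\<^sub>0 'k) ring" and ?I = "edge_ideal V E :: (('v \<Rightarrow>\<^sub>0 nat) \<Rightarrow>\<^sub>0 'k) set"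
  let ?S = "{e. \<forall>C. minimal_vertex_cover V E C \<longrightarrow> t \<le> vertex_weight C e}"
  interpret cring ?R by (rule cring_poly_ring)
  have I: "ideal ?I ?R"
    unfolding edge_ideal_eq_mono_ideal[OF edge_subset] by (rule ideal_mono_ideal)
  have It: "ideal_power ?R ?I t = mono_ideal V (edge_sums E t)" by (rule ideal_power_edge_ideal[OF edge_subset])
  have contraction: "h \<in> local_contraction ?R p (ideal_power ?R ?I t)
      \<longleftrightarrow> h \<in> carrier ?R \<and> (\<exists>s \<in> carrier ?R - p. s * h \<in> mono_ideal V (edge_sums E t))"
    if "p \<in> ass_primes ?R ?I" for p h
  proof -
    have "primeideal p ?R" using that by (simp add: ass_primes_def)
    then show ?thesis
      unfolding It using mem_local_contraction_iff[OF _ ideal_mono_ideal] by simp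
  qed
  show "symbolic_power ?R ?I t \<subseteq> mono_ideal V ?S"
  proof
    fix h assume h: "h \<in> symbolic_power ?R ?I t"
    then have "h \<in> carrier ?R" by (simp add: symbolic_power_def)
    have "h \<in> mono_ideal V {e. t \<le> vertex_weight C e}" if C: "minimal_vertex_cover V E C" for C
    proof -
      note ass = ass_prime_of_minimal_cover[OF C, where 'k = 'k]
      then obtain s where s: "s \<in> carrier ?R - mono_ideal V {e. 1 \<le> vertex_weight C e}"
          "s * h \<in> mono_ideal V (edge_sums E t)"
        using h contraction[OF ass] unfolding symbolic_power_def by blast
      have "vertex_cover V E C" using C by (simp add: minimal_vertex_cover_def)
      then have "mono_ideal V (edge_sums E t) \<subseteq> (mono_ideal V {e. t \<le> vertex_weight C e} :: (('v \<Rightarrow>\<^sub>0 nat) \<Rightarrow>\<^sub>0 'k) set)"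
        by (intro mono_ideal_subset) (metis (mono_tags) add_0_right edge_sums_weight mem_Collect_eq)
      with s show ?thesis
        using weight_ideal_primary[OF \<open>h \<in> carrier ?R\<close>] by blast
    qed
    then have "\<forall>e \<in> Poly_Mapping.keys h. e \<in> ?S"
      by (simp add: mem_weight_ideal_iff)
    with \<open>h \<in> carrier ?R\<close> show "h \<in> mono_ideal V ?S"
      by (intro mono_idealI) simp_all
  qed
  show "mono_ideal V ?S \<subseteq> symbolic_power ?R ?I t"
  proof
    fix h :: "('v \<Rightarrow>\<^sub>0 nat) \<Rightarrow>\<^sub>0 'k" assume h: "h \<in> mono_ideal V ?S"
    have hc: "h \<in> carrier ?R" using h by (simp add: mono_ideal_def)
    have weight: "t \<le> vertex_weight C e" if "minimal_vertex_cover V E C" "e \<in> Poly_Mapping.keys h" for C e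
      using h that by (fastforce simp: mono_ideal_def vertex_weight_add)
    have "h \<in> local_contraction ?R p (ideal_power ?R ?I t)" if ass: "p \<in> ass_primes ?R ?I" for p
    proof -
      interpret p: primeideal p ?R using ass by (simp add: ass_primes_def)
      obtain C nb where C: "minimal_vertex_cover V E C"
        and nb: "\<And>v. v \<in> C \<Longrightarrow> {v, nb v} \<in> E \<and> pvar (nb v) \<notin> p"
        by (rule ass_prime_cover[OF ass]) blast
      have "finite C"
        using C finite_V by (auto simp: minimal_vertex_cover_def vertex_cover_def intro: finite_subset)
      have nbV: "nb v \<in> V" if "v \<in> C" for v using nb that edge_ends by blast
      \<comment> \<open>\<open>t\<close> copies of the neighbour \<open>nb v\<close> of each cover
        vertex are enough for any choice of \<open>t\<close> factors from \<open>C\<close>. The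
        product stays outside \<open>p\<close>, which is prime and contains none of these
        variables.\<close>
      define \<sigma> where "\<sigma> = (\<Sum>v \<in> C. Poly_Mapping.single (nb v) t)"
      have add: "monomial (a + b) \<in> carrier ?R - p" if "monomial a \<in> carrier ?R - p" "monomial b \<in> carrier ?R - p"
        for a b
      proof -
        have "monomial (a + b) = monomial a \<otimes>\<^bsub>?R\<^esub> monomial b"
          by (simp add: monomial_def mult_single)
        then show ?thesis
          using that p.I_prime[of "monomial a" "monomial b"] m_closed[of "monomial a" "monomial b"] by auto
      qed
      have zero: "monomial 0 \<in> carrier ?R - p"
        using p.one_imp_carrier p.I_notcarr by (auto simp: monomial_def)
      have single: "monomial (Poly_Mapping.single (nb v) k) \<in> carrier ?R - p" if v: "v \<in> C" for v k
      proof (induction k)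
        case (Suc k)
        have "pvar (nb v) \<in> carrier ?R - p"
          using nb[OF v] nbV[OF v] by (simp add: pvar_def monomial_def)
        then have "monomial (Poly_Mapping.single (nb v) 1 + Poly_Mapping.single (nb v) k) \<in> carrier ?R - p"
          unfolding pvar_def using Suc by (rule add)
        then show ?case by (simp flip: single_add)
      qed (use zero in simp)
      have "monomial (\<Sum>v \<in> A. Poly_Mapping.single (nb v) t) \<in> carrier ?R - p" if "A \<subseteq> C" for A
        using finite_subset[OF that \<open>finite C\<close>] that
      proof (induction A rule: finite_induct)
        case empty
        show ?case using zero by simp
      next
        case (insert x A)
        then have "monomial (Poly_Mapping.single (nb x) t) \<in> carrier ?R - p"
          "monomial (\<Sum>v \<in> A. Poly_Mapping.single (nb v) t) \<in> carrier ?R - p"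
          using single[of x t] by simp_all
        from add[OF this] show ?case by (simp only: sum.insert[OF insert(1,2)])
      qed
      from this[OF subset_refl] have \<sigma>: "monomial \<sigma> \<in> carrier ?R - p" by (simp only: \<sigma>_def)
      have "\<forall>e' \<in> Poly_Mapping.keys (monomial \<sigma> * h).
          Poly_Mapping.keys e' \<subseteq> V \<and> (\<exists>s \<in> edge_sums E t. \<exists>d. e' = s + d)"
        unfolding keys_monomial_mult
      proof
        fix e' assume "e' \<in> (+) \<sigma> ` Poly_Mapping.keys h"
        then obtain e where e: "e \<in> Poly_Mapping.keys h" "e' = \<sigma> + e" by (auto elim: imageE)
        obtain g where g: "\<And>v. g v \<le> Poly_Mapping.lookup e v" "sum g C = t"
          using exists_smaller_sum[OF \<open>finite C\<close>] weight[OF C e(1)] unfolding vertex_weight_def by metis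
        \<comment> \<open>Of the \<open>t\<close> factors chosen from \<open>e\<close>,
          \<open>g v\<close> equal \<open>v\<close>; each is paired with a copy of
          \<open>nb v\<close> from \<open>\<sigma>\<close> to form an edge.\<close>
        let ?\<tau> = "\<Sum>v \<in> C. Poly_Mapping.single v (g v) + Poly_Mapping.single (nb v) (g v)"
        have "?\<tau> \<in> edge_sums E (sum g C)"
          using nb by (intro edge_sums_sum[OF \<open>finite C\<close>] edge_sums_multiple) blast
        moreover have "Poly_Mapping.lookup ?\<tau> x \<le> Poly_Mapping.lookup (\<sigma> + e) x" for x
        proof -
          have "(\<Sum>v \<in> C. g v when v = x) \<le> Poly_Mapping.lookup e x"
            using \<open>finite C\<close> g(1)[of x] by (simp add: when_def)
          \<comment> \<open>Several cover vertices may share a neighbour, so exponents are compared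
            as sums over \<open>C\<close>.\<close>
          moreover have "(\<Sum>v \<in> C. g v when nb v = x) \<le> (\<Sum>v \<in> C. t when nb v = x)"
          proof (intro sum_mono)
            fix v assume "v \<in> C"
            then have "g v \<le> t" using g(2) \<open>finite C\<close> member_le_sum[of v C g] by simp
            then show "(g v when nb v = x) \<le> (t when nb v = x)" by (simp add: when_def)
          qed
          ultimately show ?thesis
            by (simp add: \<sigma>_def lookup_add lookup_sum lookup_single sum.distrib)
        qed
        ultimately have "\<exists>s \<in> edge_sums E t. \<exists>d. \<sigma> + e = s + d"
          unfolding divides_iff_lookup_le g(2) by blast
        moreover have "Poly_Mapping.keys (\<sigma> + e) \<subseteq> V"
          using \<sigma> e(1) hc by (auto simp: monomial_def keys_add_nat)
        ultimately show "Poly_Mapping.keys e' \<subseteq> V \<and> (\<exists>s \<in> edge_sums E t. \<exists>d. e' = s + d)"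
          using e(2) by simp
      qed
      then have "monomial \<sigma> * h \<in> mono_ideal V (edge_sums E t)"
        by (simp only: mono_ideal_def mem_Collect_eq)
      with \<sigma> have "\<exists>s \<in> carrier ?R - p. s * h \<in> mono_ideal V (edge_sums E t)"
        by (rule bexI[rotated])
      with hc show ?thesis
        by (simp only: contraction[OF ass])
    qed
    with hc show "h \<in> symbolic_power ?R ?I t"
      by (simp add: symbolic_power_def)
  qed
qed

end

subsection \<open>Clique sums of two odd cycles\<close>

lemma mon_deg_add: "mon_deg (a + b) = mon_deg a + mon_deg b"
  unfolding mon_deg_def by (rule setsum_keys_plus_distrib) simp_all

lemma mon_deg_single: "mon_deg (Poly_Mapping.single v k) = k"
  by (simp add: mon_deg_def)

lemma mon_deg_0: "mon_deg 0 = 0"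
  by (simp add: mon_deg_def)

lemma mon_deg_edge_sums: "s \<in> edge_sums E a \<Longrightarrow> mon_deg s = 2 * a"
  by (induction a arbitrary: s) (auto simp: mon_deg_add mon_deg_single mon_deg_0)

lemma mon_deg_cycle_exp: "mon_deg (cycle_exp z l b) = l * b"
proof -
  have "mon_deg (sum f A) = (\<Sum>i\<in>A. mon_deg (f i))" if "finite A" for A and f :: "nat \<Rightarrow> 'a \<Rightarrow>\<^sub>0 nat"
    using that by (induction A rule: finite_induct) (simp_all add: mon_deg_add mon_deg_0)
  then show ?thesis by (simp add: cycle_exp_def mon_deg_single)
qed

lemma keys_cycle_exp: "Poly_Mapping.keys (cycle_exp z l b) \<subseteq> z ` {1..l}"
  by (auto simp: cycle_exp_def keys_sum_nat split: if_splits)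

lemma cycle_exp_0: "cycle_exp z l 0 = 0"
  by (simp add: cycle_exp_def)

lemma prod_monomial:
  "finite A \<Longrightarrow> (\<Prod>i\<in>A. monomial (f i)) = monomial (\<Sum>i\<in>A. f i)"
  by (induction A rule: finite_induct) (simp_all add: monomial_def mult_single)

lemma prod_pvar_cycle: "(\<Prod>i=1..l. pvar (z i)) = monomial (cycle_exp z l 1)"
  by (simp add: cycle_exp_def pvar_def prod_monomial)

lemma cycle_edges_ends:
  assumes "inj_on z {1..l}" "2 \<le> l" "e \<in> cycle_edges z l"
  shows "\<exists>u v. e = {u, v} \<and> u \<noteq> v \<and> u \<in> z ` {1..l} \<and> v \<in> z ` {1..l}"
proof -
  have *: "\<exists>u v. {z i, z j} = {u, v} \<and> u \<noteq> v \<and> u \<in> z ` {1..l} \<and> v \<in> z ` {1..l}"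
    if "i \<in> {1..l}" "j \<in> {1..l}" "i \<noteq> j" for i j
    using that assms(1) by (intro exI[of _ "z i"] exI[of _ "z j"]) (auto dest: inj_onD)
  from assms(3) consider i where "e = {z i, z (Suc i)}" "1 \<le> i" "i < l" | "e = {z l, z 1}"
    by (auto simp: cycle_edges_def)
  then show ?thesis
  proof cases
    case 1
    then show ?thesis using *[of i "Suc i"] by simp
  next
    case 2
    then show ?thesis using *[of l 1] assms(2) by simp
  qed
qed

text \<open>Each of the \<open>2*n+1\<close> edges has an end in \<open>C\<close>, and each position
  is counted by two edges. So at least half of the positions are in \<open>C\<close>, which after
  rounding up means \<open>n+1\<close>.\<close>

lemma odd_cycle_exp_weight:
  assumes "finite C" and cover: "\<And>e. e \<in> cycle_edges z (2*n+1) \<Longrightarrow> e \<inter> C \<noteq> {}"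
  shows "(n+1) * b \<le> vertex_weight C (cycle_exp z (2*n+1) b)"
proof -
  let ?N = "2*n+1"
  define \<chi> where "\<chi> i = (if z (i mod ?N + 1) \<in> C then 1 else (0::nat))" for i
  have "vertex_weight C (cycle_exp z ?N b) = (\<Sum>v\<in>C. \<Sum>i=1..?N. b when z i = v)"
    by (simp only: vertex_weight_def cycle_exp_def lookup_sum lookup_single)
  also have "\<dots> = (\<Sum>i=1..?N. \<Sum>v\<in>C. b when z i = v)"
    by (rule sum.swap)
  also have "\<dots> = (\<Sum>i=1..?N. if z i \<in> C then b else 0)"
    using \<open>finite C\<close> by (intro sum.cong) (simp_all add: when_def)
  also have "\<dots> = (\<Sum>i<?N. b * \<chi> i)"
    by (rule sum.reindex_bij_witness[of _ Suc "\<lambda>i. i - 1"]) (auto simp: \<chi>_def)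
  also have "\<dots> = b * (\<Sum>i<?N. \<chi> i)"
    by (simp only: sum_distrib_left)
  finally have eq: "vertex_weight C (cycle_exp z ?N b) = b * (\<Sum>i<?N. \<chi> i)" .
  have "1 \<le> \<chi> i + \<chi> (Suc i)" for i
  proof -
    have "{z (i mod ?N + 1), z (Suc i mod ?N + 1)} \<in> cycle_edges z ?N"
      by (subst cycle_edges_mod) auto
    from cover[OF this] show ?thesis by (auto simp: \<chi>_def)
  qed
  then have "(\<Sum>i<?N. 1) \<le> (\<Sum>i<?N. \<chi> i + \<chi> (Suc i))"
    by (intro sum_mono)
  also have "\<dots> = 2 * (\<Sum>i<?N. \<chi> i)"
    using sum_shift_periodic[of \<chi> ?N] by (simp only: sum.distrib \<chi>_def mod_add_self2)
  finally have "n + 1 \<le> (\<Sum>i<?N. \<chi> i)" by simp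
  then have "b * (n+1) \<le> b * (\<Sum>i<?N. \<chi> i)" by (rule mult_le_mono2)
  then show ?thesis unfolding eq by (simp only: mult.commute)
qed

lemma clique_sum_decomposition:
  fixes x y :: "nat \<Rightarrow> 'v"
  assumes "1 \<le> n" "1 \<le> m" and x: "inj_on x {1..2*n+1}" and y: "inj_on y {1..2*m+1}"
    and r: "x ` {1..2*n+1} \<inter> y ` {1..2*m+1} = {x 1}"
    and V: "V = x ` {1..2*n+1} \<union> y ` {1..2*m+1}"
    and E: "E = cycle_edges x (2*n+1) \<union> cycle_edges y (2*m+1)"
    and cover: "\<And>C. vertex_cover V E C \<Longrightarrow> t \<le> vertex_weight C e"
  obtains a b c s where "s \<in> edge_sums E a" "a + (n+1) * b + (m+1) * c = t"
    "\<exists>d. e = s + cycle_exp x (2*n+1) b + cycle_exp y (2*m+1) c + d"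
proof -
  let ?N = "2*n+1" and ?M = "2*m+1"
  let ?V1 = "x ` {1..?N}" and ?V2 = "y ` {1..?M}" and ?w = "Poly_Mapping.lookup e"
  have E1: "f \<subseteq> ?V1 \<and> \<not> f \<subseteq> {x 1}" if "f \<in> cycle_edges x ?N" for f
    using cycle_edges_ends[OF x _ that] \<open>1 \<le> n\<close> by auto
  have E2: "f \<subseteq> ?V2 \<and> \<not> f \<subseteq> {x 1}" if "f \<in> cycle_edges y ?M" for f
    using cycle_edges_ends[OF y _ that] \<open>1 \<le> m\<close> by auto
  have "t \<le> sum ?w C" if "vertex_cover (?V1 \<union> ?V2) (cycle_edges x ?N \<union> cycle_edges y ?M) C" for C
    using cover[of C] that by (simp only: V E vertex_weight_def)
  then obtain k1 k2 t1 t2 where k: "k1 + k2 \<le> ?w (x 1)" and t: "t1 + t2 = t"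
    and 1: "\<And>C. vertex_cover ?V1 (cycle_edges x ?N) C \<Longrightarrow> t1 \<le> sum (?w(x 1 := k1)) C"
    and 2: "\<And>C. vertex_cover ?V2 (cycle_edges y ?M) C \<Longrightarrow> t2 \<le> sum (?w(x 1 := k2)) C"
    using clique_sum_split[OF _ _ r E1 E2] by (metis finite_atLeastAtMost finite_imageI)
  obtain a1 b s1 where 3: "s1 \<in> edge_sums (cycle_edges x ?N) a1" "a1 + (n+1) * b = t1"
    "\<And>v. Poly_Mapping.lookup (s1 + cycle_exp x ?N b) v \<le> (if v \<in> ?V1 then (?w(x 1 := k1)) v else 0)"
    using odd_cycle_decomposition[OF x 1] by blast
  obtain a2 c s2 where 4: "s2 \<in> edge_sums (cycle_edges y ?M) a2" "a2 + (m+1) * c = t2"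
    "\<And>v. Poly_Mapping.lookup (s2 + cycle_exp y ?M c) v \<le> (if v \<in> ?V2 then (?w(x 1 := k2)) v else 0)"
    using odd_cycle_decomposition[OF y 2] by blast
  show ?thesis
  proof (rule that)
    show "s1 + s2 \<in> edge_sums E (a1 + a2)"
      using 3(1) 4(1) edge_sums_mono[of _ E] unfolding E by (intro edge_sums_add) blast+
    show "a1 + a2 + (n+1) * b + (m+1) * c = t"
      using 3(2) 4(2) t by simp
    \<comment> \<open>Both bounds are active only at \<open>x 1\<close>, where they add up to
      \<open>k1 + k2\<close>; any other vertex lies on at most one cycle.\<close>
    have "(if v \<in> ?V1 then (?w(x 1 := k1)) v else 0) + (if v \<in> ?V2 then (?w(x 1 := k2)) v else 0) \<le> ?w v" for v
    proof (cases "v = x 1")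
      case True
      then show ?thesis using k by simp
    next
      case False
      with r have "\<not> (v \<in> ?V1 \<and> v \<in> ?V2)" by blast
      with False show ?thesis by auto
    qed
    then have "Poly_Mapping.lookup (s1 + cycle_exp x ?N b) v + Poly_Mapping.lookup (s2 + cycle_exp y ?M c) v \<le> ?w v" for v
      using add_mono[OF 3(3)[of v] 4(3)[of v]] le_trans by blast
    then show "\<exists>d. e = s1 + s2 + cycle_exp x ?N b + cycle_exp y ?M c + d"
      unfolding divides_iff_lookup_le by (simp add: lookup_add algebra_simps)
  qed
qed

theorem theorem3p14:
  fixes n m :: nat
    and x y :: "nat \<Rightarrow> 'v"
    and V :: "'v set"
    and E :: "'v set set"
    and R :: "(('v \<Rightarrow>\<^sub>0 nat) \<Rightarrow>\<^sub>0 'k::field) ring"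
    and I :: "(('v \<Rightarrow>\<^sub>0 nat) \<Rightarrow>\<^sub>0 'k) set"
    and c1 c2 :: "('v \<Rightarrow>\<^sub>0 nat) \<Rightarrow>\<^sub>0 'k"
  assumes "1 \<le> n" and "n < m"
    and "inj_on x {1..2*n+1}" and "inj_on y {1..2*m+1}"
    and "y 1 = x 1"
    and "x ` {1..2*n+1} \<inter> y ` {1..2*m+1} = {x 1}"
    and "V = x ` {1..2*n+1} \<union> y ` {1..2*m+1}"
    and "E = cycle_edges x (2*n+1) \<union> cycle_edges y (2*m+1)"
    and "R = poly_ring V"
    and "I = edge_ideal V E"
    and "c1 = (\<Prod>i=1..2*n+1. pvar (x i))"
    and "c2 = (\<Prod>i=1..2*m+1. pvar (y i))"
  shows "(\<forall>t. 1 \<le> t \<and> t \<le> n \<longrightarrow> symbolic_power R I t = ideal_power R I t) \<and>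
    symbolic_power R I (n+1) = ideal_power R I (n+1) <+>\<^bsub>R\<^esub> Idl\<^bsub>R\<^esub> {c1} \<and>
    (\<forall>t. n + 2 \<le> t \<and> t \<le> m + 1 \<longrightarrow>
       symbolic_power R I t = ideal_power R I t <+>\<^bsub>R\<^esub> Idl\<^bsub>R\<^esub> (D_set V E t))"
proof -
  let ?N = "2*n+1" and ?M = "2*m+1"
  note n = assms(1) and V = assms(7) and E = assms(8)
  have m: "1 \<le> m" using assms(1,2) by simp
  interpret finite_simple_graph V E
  proof
    show "finite V" by (simp add: V)
    show "\<exists>u v. e = {u, v} \<and> u \<noteq> v \<and> u \<in> V \<and> v \<in> V" if "e \<in> E" for e
    proof -
      from that consider "e \<in> cycle_edges x ?N" | "e \<in> cycle_edges y ?M" by (auto simp: E)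
      then show ?thesis
      proof cases
        case 1
        then show ?thesis using cycle_edges_ends[OF assms(3) _ 1] n unfolding V by fastforce
      next
        case 2
        then show ?thesis using cycle_edges_ends[OF assms(4) _ 2] m unfolding V by fastforce
      qed
    qed
  qed
  let ?S = "\<lambda>t. {e. \<forall>C. minimal_vertex_cover V E C \<longrightarrow> t \<le> vertex_weight C e}"
  have symb: "symbolic_power R I t = mono_ideal V (?S t)" for t
    unfolding assms(9,10) by (rule symbolic_power_edge_ideal)
  have pow: "ideal_power R I t = mono_ideal V (edge_sums E t)" for t
    unfolding assms(9,10) by (rule ideal_power_edge_ideal[OF edge_subset])
  have finite_cover: "finite C" if "vertex_cover V E C" for C
    using that finite_V by (auto simp: vertex_cover_def intro: finite_subset)
  have edge_S: "edge_sums E t \<subseteq> ?S t" for t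
    using edge_sums_weight by (auto simp: minimal_vertex_cover_def)
  have cyc_weight: "(n+1) * b \<le> vertex_weight C (cycle_exp x ?N b)"
      "(m+1) * b \<le> vertex_weight C (cycle_exp y ?M b)" if "vertex_cover V E C" for C b
    using vertex_cover_edge[OF that]
    by (intro odd_cycle_exp_weight[OF finite_cover[OF that]]; simp add: E)+
  have decomp: "\<exists>a b c s. s \<in> edge_sums E a \<and> a + (n+1) * b + (m+1) * c = t \<and>
      (\<exists>d. e = s + cycle_exp x ?N b + cycle_exp y ?M c + d)" if "e \<in> ?S t" for e t
  proof -
    \<comment> \<open>The symbolic power tests minimal covers, the decomposition asks for all
      covers; a cover weighs at least as much as a minimal one inside it.\<close>
    have "t \<le> vertex_weight C e" if C: "vertex_cover V E C" for C
    proof -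
      obtain C' where C': "C' \<subseteq> C" "minimal_vertex_cover V E C'"
        using vertex_cover_contains_minimal[OF C] .
      then have "t \<le> vertex_weight C' e" using \<open>e \<in> ?S t\<close> by blast
      also have "\<dots> \<le> vertex_weight C e"
        unfolding vertex_weight_def using finite_cover[OF C] C'(1) by (intro sum_mono2) auto
      finally show ?thesis .
    qed
    from clique_sum_decomposition[OF n m assms(3,4,6) V E this] show ?thesis by metis
  qed
  have eqI: "mono_ideal V (?S t) = (mono_ideal V T :: (('v \<Rightarrow>\<^sub>0 nat) \<Rightarrow>\<^sub>0 'k) set)"
    if "T \<subseteq> ?S t" "\<And>e. e \<in> ?S t \<Longrightarrow> Poly_Mapping.keys e \<subseteq> V \<Longrightarrow> \<exists>s\<in>T. \<exists>d. e = s + d" for t T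
  proof (rule antisym)
    show "mono_ideal V (?S t) \<subseteq> (mono_ideal V T :: (('v \<Rightarrow>\<^sub>0 nat) \<Rightarrow>\<^sub>0 'k) set)"
      using that(2) by (rule mono_ideal_subset)
    show "mono_ideal V T \<subseteq> (mono_ideal V (?S t) :: (('v \<Rightarrow>\<^sub>0 nat) \<Rightarrow>\<^sub>0 'k) set)"
    proof (rule mono_ideal_subset)
      fix s assume "s \<in> T"
      then show "\<exists>e\<in>?S t. \<exists>d. s = e + d" using that(1) by (intro bexI[of _ s] exI[of _ 0]) auto
    qed
  qed
  have le_mult: "(n+1) * b < n + 2 \<longleftrightarrow> b = 0 \<or> b = 1" "(n+1) * b < n + 1 \<longleftrightarrow> b = 0" for b
    using n by (cases b; cases "b - 1"; simp)+
  have le_mult': "(m+1) * c < m + 1 \<longleftrightarrow> c = 0" for c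
    by (cases c) simp_all

  have "symbolic_power R I t = ideal_power R I t" if "t \<le> n" for t
    unfolding symb pow
  proof (rule eqI[OF edge_S])
    fix e assume "e \<in> ?S t"
    then obtain a b c s d where *: "s \<in> edge_sums E a" "a + (n+1) * b + (m+1) * c = t"
      "e = s + cycle_exp x ?N b + cycle_exp y ?M c + d"
      using decomp by blast
    \<comment> \<open>One copy of either cycle would already contribute more than
      \<open>t\<close>.\<close>
    have "(n+1) * b < n + 1" "(m+1) * c < m + 1"
      using * that \<open>n < m\<close> by linarith+
    then have "b = 0" "c = 0" using le_mult le_mult' by blast+
    with * have "s \<in> edge_sums E t" "e = s + d" by (simp_all add: cycle_exp_0)
    then show "\<exists>s\<in>edge_sums E t. \<exists>d. e = s + d" by blast
  qed
  moreover have "symbolic_power R I (n+1) = ideal_power R I (n+1) <+>\<^bsub>R\<^esub> Idl\<^bsub>R\<^esub> {c1}"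
  proof -
    have "Idl\<^bsub>R\<^esub> {c1} = mono_ideal V {cycle_exp x ?N 1}"
      unfolding assms(9,11) prod_pvar_cycle
      using keys_cycle_exp[of x ?N 1] by (subst mono_ideal_eq_Idl) (auto simp: V)
    then have "ideal_power R I (n+1) <+>\<^bsub>R\<^esub> Idl\<^bsub>R\<^esub> {c1} = mono_ideal V (edge_sums E (n+1) \<union> {cycle_exp x ?N 1})"
      unfolding pow by (simp only: assms(9) set_add_mono_ideal)
    moreover have "mono_ideal V (?S (n+1))
        = (mono_ideal V (edge_sums E (n+1) \<union> {cycle_exp x ?N 1}) :: (('v \<Rightarrow>\<^sub>0 nat) \<Rightarrow>\<^sub>0 'k) set)"
    proof (rule eqI)
      show "edge_sums E (n+1) \<union> {cycle_exp x ?N 1} \<subseteq> ?S (n+1)"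
        using edge_S[of "n+1"] cyc_weight(1)[of _ 1] by (auto simp: minimal_vertex_cover_def)
      fix e assume "e \<in> ?S (n+1)"
      then obtain a b c s d where *: "s \<in> edge_sums E a" "a + (n+1) * b + (m+1) * c = n+1"
        "e = s + cycle_exp x ?N b + cycle_exp y ?M c + d"
        using decomp by blast
      \<comment> \<open>A copy of the longer cycle does not fit into \<open>n+1\<close>, since
        \<open>n < m\<close>, and one copy of the shorter cycle uses it up.\<close>
      have "(n+1) * b < n + 2" "(m+1) * c < m + 1"
        using * \<open>n < m\<close> by linarith+
      then have "b = 0 \<or> b = 1" "c = 0" using le_mult le_mult' by blast+
      then consider "b = 0" "c = 0" | "b = 1" "c = 0" by blast
      then show "\<exists>s\<in>edge_sums E (n+1) \<union> {cycle_exp x ?N 1}. \<exists>d. e = s + d"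
      proof cases
        case 1
        with * have "s \<in> edge_sums E (n+1)" "e = s + d" by (simp_all add: cycle_exp_0 del: edge_sums.simps)
        then show ?thesis by blast
      next
        case 2
        with *(3) have "e = cycle_exp x ?N 1 + (s + d)" by (simp add: cycle_exp_0 ac_simps)
        then show ?thesis by blast
      qed
    qed
    ultimately show ?thesis unfolding symb by simp
  qed
  moreover have "symbolic_power R I t = ideal_power R I t <+>\<^bsub>R\<^esub> Idl\<^bsub>R\<^esub> (D_set V E t)" for t
  proof -
    let ?D = "{e. Poly_Mapping.keys e \<subseteq> V \<and> mon_deg e < 2 * t \<and> e \<in> ?S t}"
    have "D_set V E t = (monomial ` ?D :: (('v \<Rightarrow>\<^sub>0 nat) \<Rightarrow>\<^sub>0 'k) set)"
      by (auto simp: D_set_def)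
    then have "Idl\<^bsub>R\<^esub> (D_set V E t) = mono_ideal V ?D"
      unfolding assms(9) by (subst mono_ideal_eq_Idl) auto
    then have "ideal_power R I t <+>\<^bsub>R\<^esub> Idl\<^bsub>R\<^esub> (D_set V E t) = mono_ideal V (edge_sums E t \<union> ?D)"
      unfolding pow by (simp only: assms(9) set_add_mono_ideal)
    moreover have "mono_ideal V (?S t) = (mono_ideal V (edge_sums E t \<union> ?D) :: (('v \<Rightarrow>\<^sub>0 nat) \<Rightarrow>\<^sub>0 'k) set)"
    proof (rule eqI)
      show "edge_sums E t \<union> ?D \<subseteq> ?S t"
        using edge_S[of t] by auto
      fix e assume "e \<in> ?S t" and keys_e: "Poly_Mapping.keys e \<subseteq> V"
      then obtain a b c s d where *: "s \<in> edge_sums E a" "a + (n+1) * b + (m+1) * c = t"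
        "e = s + cycle_exp x ?N b + cycle_exp y ?M c + d"
        using decomp by blast
      \<comment> \<open>The cofactor \<open>d\<close> can have any degree, so it is split off. What
        remains is a product of \<open>t\<close> edges or, if a cycle occurs, has degree below
        \<open>2 * t\<close> and belongs to \<open>?D\<close>.\<close>
      define f where "f = s + cycle_exp x ?N b + cycle_exp y ?M c"
      have "mon_deg f + (b + c) = 2 * t"
        using *(1,2) by (simp add: f_def mon_deg_add mon_deg_edge_sums mon_deg_cycle_exp algebra_simps)
      \<comment> \<open>On every cover the edges contribute at least \<open>a\<close> and the cycles
        at least \<open>(n+1) * b\<close> and \<open>(m+1) * c\<close>, which add up to
        \<open>t\<close>.\<close>
      moreover have "t \<le> vertex_weight C f" if "minimal_vertex_cover V E C" for C
      proof -
        have C: "vertex_cover V E C" using that by (simp add: minimal_vertex_cover_def)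
        show ?thesis
          using edge_sums_weight[OF C *(1)] cyc_weight[OF C] *(2)
          unfolding f_def vertex_weight_add by (meson add_mono order_trans order_refl)
      qed
      moreover have "Poly_Mapping.keys f \<subseteq> V"
        using keys_e *(3) by (simp add: f_def keys_add_nat)
      moreover have "f \<in> edge_sums E t" if "b + c = 0"
        using that * by (simp add: f_def cycle_exp_0)
      ultimately have "f \<in> edge_sums E t \<union> ?D" by (cases "b + c = 0") auto
      then show "\<exists>s\<in>edge_sums E t \<union> ?D. \<exists>d. e = s + d"
        using *(3) unfolding f_def[symmetric] by blast
    qed
    ultimately show ?thesis unfolding symb by simp
  qed
  ultimately show ?thesis by blast
qed

end
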